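(* Let $Y\subset\mathbb{R}^p$ be nonempty and compact, let $\mathfrak{I}=\{1,\dots,N\}$ be a finite set of leaders, let $X_i\subset\mathbb{R}^{d_i}$ for $i\in\mathfrak{I}$, and put $X=\prod_{i\in\mathfrak{I}}X_i$. Let $S:X\rightrightarrows Y$ be a set-valued map with nonempty values and closed graph, and let $\{\beta^i: i\in\mathfrak{I}\}$ be a belief system over $S$. Assume that for each $i\in\mathfrak{I}$: (i) the cost function $\theta_i:X\times Y\to\mathbb{R}$ is continuous; (ii) $X_i$ is nonempty and compact; (iii) the belief $\beta^i:X\to\mathscr{P}(Y)$ is weak continuous. Then, for each $i\in\mathfrak{I}$, the function $x\mapsto\mathbb{E}_{\beta^i_x}(\theta_i(x,\cdot))=\int_Y\theta_i(x,y)\,d\beta^i_x(y)$ is continuous on $X$, and so the plain bilevel game in the Bayesian approach, i.e. the Nash equilibrium problem in which each player $i$ solves $\min_{x_i\in X_i}\mathbb{E}_{\beta^i_x}(\theta_i(x_i,x_{-i},\cdot))$ (with $x=(x_i,x_{-i})$), admits a mixed equilibrium.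
   Context: $\mathscr{P}(Z)$ denotes the set of Borel probability measures on $Z$ with the topology of weak convergence: $\nu_n\to\nu$ weakly if $\int f\,d\nu_n\to\int f\,d\nu$ for all continuous $f:Z\to\mathbb{R}$ with bounded support. A map $\beta:X\to\mathscr{P}(Y)$, $x\mapsto\beta_x$, is weak continuous if $x_n\to x$ in $X$ implies $\beta_{x_n}\to\beta_x$ weakly. A belief over $S$ (a set-valued map with nonempty Borel measurable values) is a map $\beta:X\to\mathscr{P}(Y)$ with $\beta_x(S(x))=1$ for all $x\in X$; a belief system is a finite family of beliefs over $S$. A bilevel game is plain if each leader's feasible set is all of $X_i$, independently of the other leaders' decisions, and $S(x)\ne\emptyset$ for all $x\in X$. Mixed equilibrium: for a Nash equilibrium problem with objectives $\varphi_i:X\to\mathbb{R}$ (measurable and bounded from below) to be minimized by player $i$ over $x_i\in X_i$, a mixed equilibrium is a tuple $(\nu_1,\dots,\nu_N)\in\mathscr{P}(X_1)\times\cdots\times\mathscr{P}(X_N)$ such that for every $i$, $\nu_i$ minimizes $\nu\mapsto\int_{X_i}\int_{X_{-i}}\varphi_i(x_i,x_{-i})\,d\nu_{-i}(x_{-i})\,d\nu(x_i)$ over $\nu\in\mathscr{P}(X_i)$, where $X_{-i}=\prod_{j\ne i}X_j$ and $\nu_{-i}=\bigotimes_{j\neq i}\nu_j$. *)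

theory Defs
  imports "HOL-Probability.Probability"
begin

text \<open>
  The strategy set of leader \<open>i\<close> is a subset of R^(d i) with \<open>d i\<close> depending on \<open>i\<close>, so it cannot be
  a set over one type \<open>real ^ 'n\<close>.  The library's \<^const>\<open>Euclidean_space\<close> is used instead: points of
  R^n are sequences vanishing from index \<open>n\<close> on.  Its topology is the one induced by the type
  \<^typ>\<open>nat \<Rightarrow> real\<close>, so \<^const>\<open>compact\<close>, \<^const>\<open>continuous_on\<close> and \<^const>\<open>borel\<close> of that type
  have their Euclidean meaning on such sets.
\<close>

lemma Euclidean_space_eq_top_of_set:
  "Euclidean_space n = top_of_set (topspace (Euclidean_space n))"
  by (simp add: Euclidean_space_def euclidean_product_topology)

definition borel_probs :: "'a::topological_space set \<Rightarrow> 'a measure set" where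
  "borel_probs Z = space (prob_algebra (restrict_space borel Z))"

lemma mem_borel_probs_iff:
  "\<mu> \<in> borel_probs Z \<longleftrightarrow> sets \<mu> = sets (restrict_space borel Z) \<and> prob_space \<mu>"
  by (auto simp: borel_probs_def space_prob_algebra)

text \<open>Test functions are the continuous functions with bounded support (neither boundedness of the
  function nor compactness of the support is asked for).\<close>

definition weak_conv_on :: "'a::metric_space set \<Rightarrow> (nat \<Rightarrow> 'a measure) \<Rightarrow> 'a measure \<Rightarrow> bool" where
  "weak_conv_on Z \<nu>s \<nu> \<longleftrightarrow>
     (\<forall>f::'a \<Rightarrow> real. continuous_on Z f \<and> bounded {z \<in> Z. f z \<noteq> 0} \<longrightarrow>
        (\<lambda>n. \<integral>z. f z \<partial>\<nu>s n) \<longlonglongrightarrow> (\<integral>z. f z \<partial>\<nu>))"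

definition weak_continuous_on ::
  "'a::topological_space set \<Rightarrow> 'b::metric_space set \<Rightarrow> ('a \<Rightarrow> 'b measure) \<Rightarrow> bool" where
  "weak_continuous_on X Y \<beta> \<longleftrightarrow>
     (\<forall>xs. \<forall>x\<in>X. (\<forall>n. xs n \<in> X) \<and> xs \<longlonglongrightarrow> x \<longrightarrow> weak_conv_on Y (\<lambda>n. \<beta> (xs n)) (\<beta> x))"

text \<open>The last conjunct forces every \<open>S x\<close> to be nonempty and Borel in \<open>Y\<close>, since \<^const>\<open>measure\<close>
  is zero on non-measurable sets.\<close>

definition belief ::
  "'a set \<Rightarrow> 'b::topological_space set \<Rightarrow> ('a \<Rightarrow> 'b set) \<Rightarrow> ('a \<Rightarrow> 'b measure) \<Rightarrow> bool" where
  "belief X Y S \<beta> \<longleftrightarrow> (\<forall>x\<in>X. \<beta> x \<in> borel_probs Y \<and> measure (\<beta> x) (S x) = 1)"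

definition bayes_cost ::
  "('i \<Rightarrow> 'a \<times> 'b \<Rightarrow> real) \<Rightarrow> ('i \<Rightarrow> 'a \<Rightarrow> 'b measure) \<Rightarrow> 'i \<Rightarrow> 'a \<Rightarrow> real" where
  "bayes_cost \<theta> \<beta> i x = (\<integral>y. \<theta> i (x, y) \<partial>\<beta> i x)"

text \<open>A profile of the opponents of \<open>i\<close> is an element \<open>x\<close> of \<open>\<Pi>\<^sub>E j\<in>I - {i}. X j\<close>, and the full profile
  \<open>(t, x)\<close> is \<open>x(i := t)\<close>.  The Bochner integrals are meaningful for bounded Borel objectives, in
  particular for continuous objectives on compact strategy sets; an objective that is unbounded above
  would need an extended-valued integral.\<close>

definition mixed_cost ::
  "'i set \<Rightarrow> ('i \<Rightarrow> ('i \<Rightarrow> 'a) \<Rightarrow> real) \<Rightarrow> ('i \<Rightarrow> 'a measure) \<Rightarrow> 'i \<Rightarrow> 'a measure \<Rightarrow> real" where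
  "mixed_cost I \<phi> \<nu> i \<mu> =
     (\<integral>t. (\<integral>x. \<phi> i (x(i := t)) \<partial>(\<Pi>\<^sub>M j\<in>I - {i}. \<nu> j)) \<partial>\<mu>)"

definition mixed_equilibrium ::
  "'i set \<Rightarrow> ('i \<Rightarrow> 'a::topological_space set) \<Rightarrow> ('i \<Rightarrow> ('i \<Rightarrow> 'a) \<Rightarrow> real) \<Rightarrow>
     ('i \<Rightarrow> 'a measure) \<Rightarrow> bool" where
  "mixed_equilibrium I X \<phi> \<nu> \<longleftrightarrow>
     (\<forall>i\<in>I. \<nu> i \<in> borel_probs (X i) \<and>
        (\<forall>\<mu>\<in>borel_probs (X i). mixed_cost I \<phi> \<nu> i (\<nu> i) \<le> mixed_cost I \<phi> \<nu> i \<mu>))"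

end

theory Submission imports Defs begin

text \<open>
  Continuity of the expected costs follows from weak convergence, because a continuous cost on a
  compact set is uniformly continuous. For the equilibrium, restrict every leader to finitely many
  points of a dense sequence; Brouwer's fixed point theorem gives a Nash equilibrium of the finite
  game. Compact strategy sets are continuous images of compact sets of reals, so Helly selection
  and Skorohod's theorem turn a subsequence of these equilibria into random variables that converge
  pointwise. By dominated convergence the limit laws are optimal against every point of the dense
  sequences, by continuity against every pure strategy, and by integration against every mixed one.
\<close>

section \<open>Product topology and Brouwer's theorem on cubes\<close>

text \<open>The costs need not be convex in a player's own strategy, so continuity alone yields no
  pure equilibrium, whereas mixing makes each finite game multilinear. The obstacle is the limit: in
  \<open>mixed_cost\<close> all factors of the product measure move with the stage of the
  approximation, and so does the law of the player concerned. Random variables that converge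
  everywhere settle this. The product of the spaces \<open>\<Omega> j\<close> keeps the players
  independent, and the cost becomes an integral of bounded functions that converge pointwise. Helly
  selection and Skorohod's theorem concern laws on the real line, while strategies are sequences of
  reals; hence the parametrisation of each \<open>X i\<close> by a compact set of reals. Its
  continuity carries convergence of parameters over to strategies.\<close>

lemma PiE_eq_PiE_UNIV: "PiE I X = PiE UNIV (\<lambda>i. if i \<in> I then X i else {undefined})"
  by (auto simp: PiE_iff extensional_def split: if_splits)

text \<open>Tychonoff for the full function type: the coordinates outside \<open>I\<close> range
  over the one-point set \<open>{undefined}\<close>.\<close>

lemma compact_PiE:
  fixes X :: "'i \<Rightarrow> 'a::topological_space set"
  assumes "\<And>i. i \<in> I \<Longrightarrow> compact (X i)"
  shows "compact (PiE I X)"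
proof -
  have "compactin (product_topology (\<lambda>i. euclidean) UNIV) (PiE I X)"
    by (subst PiE_eq_PiE_UNIV, subst compactin_PiE) (use assms in auto)
  then show ?thesis by (simp add: euclidean_product_topology)
qed

lemma tendsto_fun_iff:
  fixes f :: "'b \<Rightarrow> 'i \<Rightarrow> 'a::topological_space"
  shows "(f \<longlongrightarrow> l) F \<longleftrightarrow> (\<forall>i. ((\<lambda>x. f x i) \<longlongrightarrow> l i) F)"
proof -
  have "limitin (product_topology (\<lambda>i. euclidean) UNIV) f l F \<longleftrightarrow> (\<forall>i. limitin euclidean (\<lambda>x. f x i) (l i) F)"
    by (subst limitin_componentwise) auto
  then show ?thesis by (simp add: euclidean_product_topology)
qed

lemma tendsto_PiE:
  fixes f :: "nat \<Rightarrow> 'i \<Rightarrow> 'a::topological_space"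
  assumes "\<And>n. f n \<in> PiE I X" "l \<in> PiE I X" "\<And>i. i \<in> I \<Longrightarrow> (\<lambda>n. f n i) \<longlonglongrightarrow> l i"
  shows "f \<longlonglongrightarrow> l"
  unfolding tendsto_fun_iff
proof
  fix i show "(\<lambda>n. f n i) \<longlonglongrightarrow> l i"
  proof (cases "i \<in> I")
    case False
    then have "(\<lambda>n. f n i) = (\<lambda>n. l i)" using assms(1,2) by (auto simp: PiE_iff extensional_def)
    then show ?thesis by simp
  qed (use assms in auto)
qed

lemma continuous_on_fun_component:
  "continuous_on S (\<lambda>x::'i \<Rightarrow> 'a::topological_space. x i)"
  by (rule continuous_on_product_then_coordinatewise) (rule continuous_on_id)

text \<open>The library's Brouwer theorem fixes the dimension by a type, but here the number of pure
  strategies must vary; Kuhn's combinatorial lemma has no such restriction.\<close>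

lemma brouwer_PiE:
  fixes F :: "('a::countable \<Rightarrow> real) \<Rightarrow> 'a \<Rightarrow> real"
  assumes "finite A"
    and cont: "\<And>a. a \<in> A \<Longrightarrow> continuous_on (PiE A (\<lambda>_. {0..1})) (\<lambda>x. F x a)"
    and F01: "\<And>x a. x \<in> PiE A (\<lambda>_. {0..1}) \<Longrightarrow> a \<in> A \<Longrightarrow> F x a \<in> {0..1}"
  obtains x where "x \<in> PiE A (\<lambda>_. {0..1})" "\<And>a. a \<in> A \<Longrightarrow> F x a = x a"
proof -
  define C where "C = PiE A (\<lambda>_. {0..1::real})"
  define n where "n = card A"
  obtain h where h: "bij_betw h {..<n} A"
    using ex_bij_betw_nat_finite[OF \<open>finite A\<close>] by (auto simp: n_def lessThan_atLeast0)
  define k where "k = the_inv_into {..<n} h"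
  have k: "k a < n" "h (k a) = a" if "a \<in> A" for a
    using h that the_inv_into_into[of h "{..<n}" a "{..<n}"] f_the_inv_into_f[of h "{..<n}" a]
    by (auto simp: k_def bij_betw_def)
  have kh: "h i \<in> A" "k (h i) = i" if "i < n" for i
    using h that by (auto simp: k_def bij_betw_def the_inv_into_f_f)
  \<comment> \<open>Grid points of mesh \<open>1 / Suc p\<close>; \<open>Suc\<close> keeps the
    denominator positive for every \<open>p\<close>. Kuhn's lemma speaks of \<open>{..<n}\<close>,
    hence the enumeration \<open>h\<close> of \<open>A\<close> and its inverse
    \<open>k\<close>.\<close>
  define pt where "pt p y = (\<lambda>a\<in>A. real (y (k a)) / real (Suc p))" for p and y :: "nat \<Rightarrow> nat"
  have pt_C: "pt p y \<in> C" if "\<And>i. i < n \<Longrightarrow> y i \<le> Suc p" for p y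
    unfolding C_def pt_def using k(1) that by (force simp: divide_simps)
  \<comment> \<open>What a single mesh gives: a corner \<open>Q\<close> and, for each coordinate
    \<open>a\<close> separately, nearby points \<open>R a\<close> and \<open>S a\<close> where
    \<open>F\<close> does not lower, respectively does not raise, coordinate \<open>a\<close>. These
    points may differ for different \<open>a\<close>; only the limit of finer meshes merges
    them.\<close>
  have "\<exists>Q R S. Q \<in> C \<and> (\<forall>a\<in>A. R a \<in> C \<and> S a \<in> C \<and> R a a \<le> F (R a) a \<and> F (S a) a \<le> S a a \<and>
     (\<forall>b\<in>A. \<bar>R a b - Q b\<bar> \<le> 1 / real (Suc p) \<and> \<bar>S a b - Q b\<bar> \<le> 1 / real (Suc p)))" for p
  proof -
    \<comment> \<open>Label 0 marks a coordinate that \<open>F\<close> does not lower. The clause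
      \<open>y i < Suc p\<close> forces label 1 on the upper face, as Kuhn's boundary condition
      asks; on the lower face label 0 follows from \<open>0 \<le> F\<close>.\<close>
    define label where
      "label y i = (if pt p y (h i) \<le> F (pt p y) (h i) \<and> y i < Suc p then 0 else 1::nat)" for y i
    have F: "F (pt p y) (h i) \<in> {0..1}" if "\<forall>i<n. y i \<le> Suc p" "i < n" for y i
      using F01[of "pt p y" "h i"] pt_C[of y p] kh that by (auto simp: C_def)
    have pth: "pt p y (h i) = real (y i) / real (Suc p)" if "i < n" for y i
      using kh[OF that] by (simp add: pt_def)
    obtain q where q: "\<forall>i<n. q i < Suc p"
      "\<forall>i<n. \<exists>r s. (\<forall>j<n. q j \<le> r j \<and> r j \<le> q j + 1) \<and> (\<forall>j<n. q j \<le> s j \<and> s j \<le> q j + 1) \<and> label r i \<noteq> label s i"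
    proof (rule kuhn_lemma[of "Suc p" n label])
      show "\<forall>x. (\<forall>i<n. x i \<le> Suc p) \<longrightarrow> (\<forall>i<n. x i = 0 \<longrightarrow> label x i = 0)"
        using F by (auto simp: label_def pth)
    qed (auto simp: label_def)
    have near: "\<bar>pt p y b - pt p q b\<bar> \<le> 1 / real (Suc p)"
      if "\<forall>j<n. q j \<le> y j \<and> y j \<le> q j + 1" "b \<in> A" for y b
    proof -
      have "q (k b) \<le> y (k b)" "y (k b) \<le> q (k b) + 1" using that k[OF that(2)] by auto
      then have "\<bar>real (y (k b)) - real (q (k b))\<bar> \<le> 1" by linarith
      then show ?thesis using that(2) by (simp add: pt_def diff_divide_distrib[symmetric] divide_simps)
    qed
    have "\<exists>R S. R \<in> C \<and> S \<in> C \<and> R a \<le> F R a \<and> F S a \<le> S a \<and>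
     (\<forall>b\<in>A. \<bar>R b - pt p q b\<bar> \<le> 1 / real (Suc p) \<and> \<bar>S b - pt p q b\<bar> \<le> 1 / real (Suc p))" if "a \<in> A" for a
    proof -
      obtain r s where rs: "\<forall>j<n. q j \<le> r j \<and> r j \<le> q j + 1" "\<forall>j<n. q j \<le> s j \<and> s j \<le> q j + 1"
        "label r (k a) = 0" "label s (k a) = 1"
      proof -
        obtain r s where rs: "\<forall>j<n. q j \<le> r j \<and> r j \<le> q j + 1" "\<forall>j<n. q j \<le> s j \<and> s j \<le> q j + 1"
          "label r (k a) \<noteq> label s (k a)" using q(2) k(1)[OF \<open>a \<in> A\<close>] by blast
        show ?thesis
        proof (cases "label r (k a) = 0")
          case True
          then have "label s (k a) = 1" using rs(3) by (auto simp: label_def split: if_splits)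
          then show ?thesis using that[of r s] rs True by blast
        next
          case False
          then have "label r (k a) = 1" "label s (k a) = 0" using rs(3) by (auto simp: label_def split: if_splits)
          then show ?thesis using that[of s r] rs by blast
        qed
      qed
      have le: "\<forall>i<n. r i \<le> Suc p" "\<forall>i<n. s i \<le> Suc p" using q(1) rs(1,2) by (fastforce intro: Suc_leI)+
      have 1: "pt p r a \<le> F (pt p r) a" using rs(3) k[OF that] by (auto simp: label_def split: if_splits)
      have 2: "F (pt p s) a \<le> pt p s a"
      \<comment> \<open>On the upper face label 1 carries no information about \<open>F\<close>, but
        there the coordinate is 1 and \<open>F\<close> is at most 1.\<close>
      proof (cases "s (k a) < Suc p")
        case True
        then show ?thesis using rs(4) k[OF that] by (auto simp: label_def split: if_splits)
      next
        case False
        then have "s (k a) = Suc p" using le k[OF that] by (metis le_antisym not_less)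
        then have "pt p s a = 1" using that by (simp add: pt_def)
        then show ?thesis using F[OF le(2) k(1)[OF that]] k[OF that] by simp
      qed
      show ?thesis using 1 2 near rs(1,2) pt_C le by (intro exI[of _ "pt p r"] exI[of _ "pt p s"]) auto
    qed
    then obtain R S where "\<forall>a\<in>A. R a \<in> C \<and> S a \<in> C \<and> R a a \<le> F (R a) a \<and> F (S a) a \<le> S a a \<and>
     (\<forall>b\<in>A. \<bar>R a b - pt p q b\<bar> \<le> 1 / real (Suc p) \<and> \<bar>S a b - pt p q b\<bar> \<le> 1 / real (Suc p))" by metis
    moreover have "pt p q \<in> C" using q(1) by (intro pt_C) (auto intro: less_imp_le)
    ultimately show ?thesis by blast
  qed
  then obtain Q R S where Q: "\<And>p. Q p \<in> C"
    and RS: "\<And>p a. a \<in> A \<Longrightarrow> R p a \<in> C \<and> S p a \<in> C \<and> R p a a \<le> F (R p a) a \<and> F (S p a) a \<le> S p a a"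
    and near: "\<And>p a b. a \<in> A \<Longrightarrow> b \<in> A \<Longrightarrow> \<bar>R p a b - Q p b\<bar> \<le> 1 / real (Suc p) \<and> \<bar>S p a b - Q p b\<bar> \<le> 1 / real (Suc p)"
    by metis
  have "seq_compact C" unfolding C_def by (intro compact_imp_seq_compact compact_PiE) auto
  then obtain x r where x: "x \<in> C" and r: "strict_mono r" and lim: "(Q \<circ> r) \<longlonglongrightarrow> x"
    using Q unfolding seq_compact_def by metis
  have Qlim: "(\<lambda>m. Q (r m) b) \<longlonglongrightarrow> x b" for b
    using lim by (simp add: tendsto_fun_iff)
  \<comment> \<open>Points within one mesh width of the corners inherit their limit, so for every
    \<open>a\<close> both inequalities pass to the same \<open>x\<close>.\<close>
  have conv: "(\<lambda>m. U (r m)) \<longlonglongrightarrow> x" if "\<And>p. U p \<in> C" "\<And>p b. b \<in> A \<Longrightarrow> \<bar>U p b - Q p b\<bar> \<le> 1 / real (Suc p)" for U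
  proof (rule tendsto_PiE)
    fix b assume b: "b \<in> A"
    have "(\<lambda>m. 1 / real (Suc (r m))) \<longlonglongrightarrow> 0"
      using LIMSEQ_subseq_LIMSEQ[OF LIMSEQ_inverse_real_of_nat r] by (simp add: o_def inverse_eq_divide)
    then have "(\<lambda>m. U (r m) b - Q (r m) b) \<longlonglongrightarrow> 0"
      by (rule Lim_null_comparison[rotated]) (use that(2)[OF b] in auto)
    from tendsto_add[OF this Qlim[of b]] show "(\<lambda>m. U (r m) b) \<longlonglongrightarrow> x b" by simp
  qed (use that x in \<open>auto simp: C_def\<close>)
  have "F x a = x a" if a: "a \<in> A" for a
  proof -
    have cs: "continuous_on C (\<lambda>x. F x a)" using cont[OF a] by (simp add: C_def)
    have R: "(\<lambda>m. R (r m) a) \<longlonglongrightarrow> x" and S: "(\<lambda>m. S (r m) a) \<longlonglongrightarrow> x"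
      using RS near a by (auto intro!: conv[of "\<lambda>p. R p a"] conv[of "\<lambda>p. S p a"])
    have FR: "(\<lambda>m. F (R (r m) a) a) \<longlonglongrightarrow> F x a" and FS: "(\<lambda>m. F (S (r m) a) a) \<longlonglongrightarrow> F x a"
      using continuous_on_tendsto_compose[OF cs R x] continuous_on_tendsto_compose[OF cs S x] RS a by auto
    have Ra: "(\<lambda>m. R (r m) a a) \<longlonglongrightarrow> x a" and Sa: "(\<lambda>m. S (r m) a a) \<longlonglongrightarrow> x a"
      using R S by (simp_all add: tendsto_fun_iff)
    show ?thesis using LIMSEQ_le[OF Ra FR] LIMSEQ_le[OF FS Sa] RS[OF a] by (auto intro: antisym)
  qed
  then show ?thesis using that x by (auto simp: C_def)
qed

section \<open>Nash equilibria of finite games\<close>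

text \<open>Weights are one function on pairs rather than a family of vectors, so a whole mixed
  profile is a point of a single cube as in \<open>brouwer_PiE\<close>.\<close>

definition mixed_weights :: "'i set \<Rightarrow> nat \<Rightarrow> ('i \<times> nat \<Rightarrow> real) set" where
  "mixed_weights I n =
     {p \<in> PiE (I \<times> {..<n}) (\<lambda>_. {0..1}). \<forall>i\<in>I. (\<Sum>k<n. p (i, k)) = 1}"

text \<open>Nash's map is defined on a product of simplices; \<open>\<rho>\<close> retracts the cube onto that product.\<close>

lemma finite_nash:
  fixes c :: "'i::countable \<Rightarrow> nat \<Rightarrow> ('i \<times> nat \<Rightarrow> real) \<Rightarrow> real"
  assumes "finite I" "n > 0"
    and cont: "\<And>i k. i \<in> I \<Longrightarrow> k < n \<Longrightarrow> continuous_on (mixed_weights I n) (c i k)"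
  obtains p where "p \<in> mixed_weights I n"
    "\<And>i k. i \<in> I \<Longrightarrow> k < n \<Longrightarrow> (\<Sum>l<n. p (i, l) * c i l p) \<le> c i k p"
proof -
  let ?A = "I \<times> {..<n}" and ?C = "PiE (I \<times> {..<n}) (\<lambda>_. {0..1::real})"
  define s where "s i w = (\<Sum>k<n. w (i, k))" for i and w :: "'i \<times> nat \<Rightarrow> real"
  \<comment> \<open>Missing mass is spread evenly over the \<open>n\<close> strategies, excess mass
    is scaled down. The total becomes \<open>(s + max 0 (1 - s)) / max 1 s = 1\<close>, the
    denominator never vanishes, and points with \<open>s = 1\<close> stay fixed.\<close>
  define \<rho> where "\<rho> w = (\<lambda>a\<in>?A. (w a + max 0 (1 - s (fst a) w) / n) / max 1 (s (fst a) w))" for w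
  define avg where "avg i p = (\<Sum>l<n. p (i, l) * c i l p)" for i p
  \<comment> \<open>\<open>g\<close> is the gain from switching to pure strategy \<open>k\<close>
    under cost minimisation; \<open>T\<close> is Nash's map, which shifts weight towards profitable
    strategies.\<close>
  define g where "g i k p = max 0 (avg i p - c i k p)" for i k p
  define T where "T p a = (p a + g (fst a) (snd a) p) / (1 + (\<Sum>l<n. g (fst a) l p))" for p a
  have g0: "g i k p \<ge> 0" for i k p by (simp add: g_def)
  have G0: "(\<Sum>l<n. g i l p) \<ge> 0" for i p by (simp add: g0 sum_nonneg)
  have weightsI: "p \<in> mixed_weights I n"
    if ext: "p \<in> extensional ?A" and nn: "\<And>i k. i \<in> I \<Longrightarrow> k < n \<Longrightarrow> 0 \<le> p (i, k)"
      and s1: "\<And>i. i \<in> I \<Longrightarrow> (\<Sum>k<n. p (i, k)) = 1" for p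
  proof -
    have "p (i, k) \<le> 1" if "i \<in> I" "k < n" for i k
      using member_le_sum[of k "{..<n}" "\<lambda>k. p (i, k)"] nn s1 that by fastforce
    then show ?thesis using that by (auto simp: mixed_weights_def PiE_iff)
  qed
  have \<rho>: "\<rho> w \<in> mixed_weights I n" if w: "w \<in> ?C" for w
  proof (rule weightsI)
    show "0 \<le> \<rho> w (i, k)" if "i \<in> I" "k < n" for i k
      using PiE_mem[OF w, of "(i, k)"] that by (auto simp: \<rho>_def intro!: divide_nonneg_nonneg add_nonneg_nonneg)
    show "(\<Sum>k<n. \<rho> w (i, k)) = 1" if "i \<in> I" for i
    proof -
      have "(\<Sum>k<n. \<rho> w (i, k)) = (\<Sum>k<n. (w (i, k) + max 0 (1 - s i w) / n) / max 1 (s i w))"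
        using that by (intro sum.cong) (auto simp: \<rho>_def)
      also have "\<dots> = (s i w + max 0 (1 - s i w)) / max 1 (s i w)"
        using \<open>n > 0\<close> by (simp add: sum_divide_distrib[symmetric] sum.distrib s_def)
      also have "\<dots> = 1" by (simp add: max_def)
      finally show ?thesis .
    qed
  qed (simp add: \<rho>_def)
  have c\<rho>: "continuous_on ?C \<rho>"
  proof (rule continuous_on_coordinatewise_then_product)
    fix a show "continuous_on ?C (\<lambda>w. \<rho> w a)"
    proof (cases "a \<in> ?A")
      case True
      have "continuous_on ?C (s (fst a))"
        unfolding s_def by (intro continuous_on_sum continuous_on_fun_component)
      then have "continuous_on ?C (\<lambda>w. (w a + max 0 (1 - s (fst a) w) / n) / max 1 (s (fst a) w))"
        by (intro continuous_on_divide continuous_on_add continuous_on_max continuous_on_diff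
            continuous_on_fun_component continuous_on_const) (use \<open>n > 0\<close> in auto)
      then show ?thesis using True by (simp add: \<rho>_def)
    qed (auto simp: \<rho>_def)
  qed
  have cavg: "continuous_on (mixed_weights I n) (avg i)" if "i \<in> I" for i
    unfolding avg_def using that by (intro continuous_on_sum continuous_on_mult cont continuous_on_fun_component) auto
  have cg: "continuous_on (mixed_weights I n) (g i k)" if "i \<in> I" "k < n" for i k
    unfolding g_def using that by (intro continuous_on_max continuous_on_diff continuous_on_const cont cavg) auto
  have cT: "continuous_on (mixed_weights I n) (\<lambda>p. T p a)" if "a \<in> ?A" for a
    unfolding T_def using that G0
    by (intro continuous_on_divide continuous_on_add continuous_on_sum continuous_on_const continuous_on_fun_component cg) (auto simp: add_nonneg_eq_0_iff)
  have Tsum: "(\<Sum>k<n. T p (i, k)) = 1" if "p \<in> mixed_weights I n" "i \<in> I" for p i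
  proof -
    have "(\<Sum>k<n. T p (i, k)) = ((\<Sum>k<n. p (i, k)) + (\<Sum>k<n. g i k p)) / (1 + (\<Sum>l<n. g i l p))"
      by (simp add: T_def sum_divide_distrib[symmetric] sum.distrib)
    then show ?thesis using that G0[of i p] by (simp add: mixed_weights_def add_nonneg_eq_0_iff)
  qed
  have Tnn: "0 \<le> T p (i, k)" if "p \<in> mixed_weights I n" "i \<in> I" "k < n" for p i k
    using that g0 G0 by (auto simp: T_def mixed_weights_def PiE_iff intro!: divide_nonneg_nonneg add_nonneg_nonneg)
  have Tle: "T p (i, k) \<le> 1" if "p \<in> mixed_weights I n" "i \<in> I" "k < n" for p i k
    using member_le_sum[of k "{..<n}" "\<lambda>k. T p (i, k)"] that Tsum Tnn by fastforce
  \<comment> \<open>\<open>T\<close> maps the product of simplices into itself, so a fixed point of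
    \<open>T \<circ> \<rho>\<close> on the cube already lies in that product; there
    \<open>\<rho>\<close> is the identity, and \<open>w\<close> is fixed by
    \<open>T\<close>.\<close>
  obtain w where w: "w \<in> ?C" "\<And>a. a \<in> ?A \<Longrightarrow> T (\<rho> w) a = w a"
  proof (rule brouwer_PiE[of ?A "\<lambda>w. T (\<rho> w)"])
    show "continuous_on ?C (\<lambda>w. T (\<rho> w) a)" if "a \<in> ?A" for a
      using continuous_on_compose2[OF cT[OF that] c\<rho>] \<rho> by auto
    show "T (\<rho> w) a \<in> {0..1}" if "w \<in> ?C" "a \<in> ?A" for w a
      using \<rho>[OF that(1)] that(2) Tnn Tle by auto
  qed (use \<open>finite I\<close> in auto)
  have wD: "w \<in> mixed_weights I n"
  proof (rule weightsI)
    show "w \<in> extensional ?A" using w(1) by (simp add: PiE_iff)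
    show "0 \<le> w (i, k)" if "i \<in> I" "k < n" for i k using w(1) that by (auto simp: PiE_iff)
    show "(\<Sum>k<n. w (i, k)) = 1" if "i \<in> I" for i
      using Tsum[OF \<rho>[OF w(1)] that] w(2) that by simp
  qed
  have "\<rho> w = w"
  proof
    fix a show "\<rho> w a = w a"
    proof (cases "a \<in> ?A")
      case True
      then have "s (fst a) w = 1" using wD by (auto simp: mixed_weights_def s_def)
      then show ?thesis using True by (simp add: \<rho>_def)
    next
      case False
      then show ?thesis using PiE_arb[OF w(1) False] unfolding \<rho>_def by (simp only: restrict_apply if_False)
    qed
  qed
  with w(2) have fixp: "T w (i, k) = w (i, k)" if "i \<in> I" "k < n" for i k using that by simp
  \<comment> \<open>Clearing the denominator in \<open>T w = w\<close>: each gain is the weight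
    times the total gain. One strategy of positive weight and zero gain therefore makes all gains of
    the player vanish.\<close>
  have gw: "g i k w = w (i, k) * (\<Sum>l<n. g i l w)" if "i \<in> I" "k < n" for i k
    using fixp[OF that] G0[of i w] by (simp add: T_def field_simps add_nonneg_eq_0_iff split: if_splits)
  have "avg i w \<le> c i k w" if ik: "i \<in> I" "k < n" for i k
  proof -
    have sum1: "(\<Sum>l<n. w (i, l)) = 1" and nn: "\<And>l. l < n \<Longrightarrow> 0 \<le> w (i, l)"
      using wD ik by (auto simp: mixed_weights_def PiE_iff)
    \<comment> \<open>The average cannot strictly exceed every cost that it weights
      positively.\<close>
    have "\<exists>l<n. w (i, l) > 0 \<and> avg i w \<le> c i l w"
    proof (rule ccontr)
      assume "\<not> ?thesis"
      then have less: "\<And>l. l < n \<Longrightarrow> w (i, l) > 0 \<Longrightarrow> c i l w < avg i w" by force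
      obtain m where m: "m < n" "w (i, m) > 0"
        using sum1 nn by (metis lessThan_iff less_eq_real_def sum.neutral zero_neq_one)
      have "(\<Sum>l<n. w (i, l) * c i l w) < (\<Sum>l<n. w (i, l) * avg i w)"
      proof (rule sum_strict_mono_strong[of _ m])
        show "w (i, l) * c i l w \<le> w (i, l) * avg i w" if "l \<in> {..<n}" for l
          using nn[of l] less[of l] that by (cases "w (i, l) = 0") (auto intro!: mult_left_mono)
      qed (use m less[of m] in auto)
      then show False using sum1 by (simp add: avg_def sum_distrib_right[symmetric])
    qed
    then obtain l where l: "l < n" "w (i, l) > 0" "avg i w \<le> c i l w" by blast
    have "g i l w = 0" using l by (simp add: g_def)
    then have "(\<Sum>l<n. g i l w) = 0" using gw[OF ik(1) l(1)] l(2) by simp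
    then have "g i k w = 0" using gw[OF ik] by simp
    then show ?thesis by (simp add: g_def max_def split: if_splits)
  qed
  then show ?thesis using that[OF wD] by (simp add: avg_def)
qed

section \<open>Compact sets as images of compact sets of reals\<close>

lemma binary_expansion:
  fixes x :: real
  assumes "x \<in> {0..1}"
  obtains b where "\<And>k. b k \<in> {0, 1::real}" "(\<lambda>k. b k * (1/2) ^ Suc k) sums x"
\<comment> \<open>The floor digits below reproduce \<open>x\<close> minus its integer part, so 1
  gets the expansion with all digits one instead.\<close>
proof (cases "x = 1")
  case True
  then show ?thesis using that[of "\<lambda>_. 1"] power_half_series by simp
next
  case False
  then have x: "0 \<le> x" "x < 1" using assms by auto
  \<comment> \<open>The partial sums telescope to
    \<open>\<lfloor>2 ^ m * x\<rfloor> / 2 ^ m\<close>, the truncation of \<open>x\<close> to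
    \<open>m\<close> binary places.\<close>
  define b where "b k = real_of_int (\<lfloor>2 ^ Suc k * x\<rfloor> - 2 * \<lfloor>2 ^ k * x\<rfloor>)" for k
  have "b k \<in> {0, 1}" for k
  proof -
    have "\<lfloor>2 * (2 ^ k * x)\<rfloor> - 2 * \<lfloor>2 ^ k * x\<rfloor> = 0 \<or> \<lfloor>2 * (2 ^ k * x)\<rfloor> - 2 * \<lfloor>2 ^ k * x\<rfloor> = 1"
      by linarith
    then show ?thesis unfolding b_def power_Suc mult.assoc by (metis insert_iff of_int_0 of_int_1)
  qed
  moreover have part: "(\<Sum>k<m. b k * (1/2) ^ Suc k) = \<lfloor>2 ^ m * x\<rfloor> / 2 ^ m" for m
  proof (induction m)
    case 0
    then show ?case using x by (simp add: floor_eq_iff)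
  qed (simp add: b_def field_simps power_divide)
  have "(\<lambda>k. b k * (1/2) ^ Suc k) sums x"
    unfolding sums_def part
  proof (rule LIM_zero_cancel, rule Lim_null_comparison[where g="\<lambda>m. (1/2) ^ m"])
    show "\<forall>\<^sub>F m in sequentially. norm (\<lfloor>2 ^ m * x\<rfloor> / 2 ^ m - x) \<le> (1/2) ^ m"
    proof (intro always_eventually allI)
      fix m
      have "\<bar>\<lfloor>2 ^ m * x\<rfloor> - 2 ^ m * x\<bar> \<le> 1" by linarith
      moreover have "\<lfloor>2 ^ m * x\<rfloor> / 2 ^ m - x = (\<lfloor>2 ^ m * x\<rfloor> - 2 ^ m * x) / 2 ^ m" by (simp add: field_simps)
      ultimately show "norm (\<lfloor>2 ^ m * x\<rfloor> / 2 ^ m - x) \<le> (1/2) ^ m"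
        by (simp add: abs_divide power_divide divide_right_mono)
    qed
  qed (intro LIMSEQ_power_zero, simp)
  ultimately show ?thesis using that by blast
qed

lemma summable_digits:
  fixes r :: real
  assumes "\<And>k. b k \<in> {0, 1}" "0 < r" "r < 1"
  shows "summable (\<lambda>k. b k * r ^ k)"
proof (rule summable_comparison_test'[of "\<lambda>k. r ^ k" 0])
  show "norm (b k * r ^ k) \<le> r ^ k" for k
    using assms(1)[of k] assms(2) by auto
qed (use assms in \<open>simp add: summable_geometric\<close>)

text \<open>At the first index \<open>m\<close> where the digits differ, the terms differ by
  \<open>(1/3) ^ m\<close>, while all later terms together contribute at most
  \<open>(1/3) ^ m / 2\<close>. In base 2 the tail could cancel the first difference; hence base 3
  with digits 0 and 1.\<close>

lemma ternary_expansion_inj: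
  fixes b b' :: "nat \<Rightarrow> real"
  assumes b: "\<And>k. b k \<in> {0, 1}" and b': "\<And>k. b' k \<in> {0, 1}"
    and eq: "(\<Sum>k. b k * (1/3) ^ k) = (\<Sum>k. b' k * (1/3) ^ k)"
  shows "b = b'"
proof (rule ccontr)
  assume "b \<noteq> b'"
  define d where "d k = (b k - b' k) * (1/3) ^ k" for k
  have sb: "summable (\<lambda>k. b k * (1/3) ^ k)" "summable (\<lambda>k. b' k * (1/3) ^ k)"
    by (intro summable_digits b b'; simp)+
  then have sd: "summable d" and d0: "suminf d = 0"
    using summable_diff[OF sb] suminf_diff[OF sb] eq by (simp_all add: d_def[abs_def] left_diff_distrib)
  define m where "m = (LEAST k. b k \<noteq> b' k)"
  have m: "b m \<noteq> b' m" using LeastI_ex[of "\<lambda>k. b k \<noteq> b' k"] \<open>b \<noteq> b'\<close> by (auto simp: m_def)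
  have below: "d k = 0" if "k < m" for k using not_less_Least[of k "\<lambda>k. b k \<noteq> b' k"] that by (simp add: m_def d_def)
  have "0 = suminf d" by (simp add: d0)
  also have "\<dots> = (\<Sum>k. d (k + Suc m)) + (\<Sum>k<Suc m. d k)"
    by (rule suminf_split_initial_segment[OF sd])
  also have "(\<Sum>k<Suc m. d k) = d m" using below by simp
  finally have dm: "\<bar>d m\<bar> = \<bar>\<Sum>k. d (k + Suc m)\<bar>" by linarith
  have le: "norm (d (k + Suc m)) \<le> (1/3) ^ Suc m * (1/3) ^ k" for k
    using b[of "k + Suc m"] b'[of "k + Suc m"] by (auto simp: d_def abs_mult power_add)
  have geo: "(\<lambda>k. (1/3) ^ Suc m * (1/3) ^ k) sums ((1/3) ^ Suc m * (1 / (1 - 1/3::real)))"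
    by (intro sums_mult geometric_sums) simp
  have sn: "summable (\<lambda>k. norm (d (k + Suc m)))"
    by (rule summable_comparison_test'[OF sums_summable[OF geo], of 0]) (use le in auto)
  have "\<bar>\<Sum>k. d (k + Suc m)\<bar> \<le> (\<Sum>k. norm (d (k + Suc m)))"
    using summable_norm[OF sn] by (simp only: real_norm_def)
  also have "\<dots> \<le> (\<Sum>k. (1/3) ^ Suc m * (1/3) ^ k)"
    by (rule suminf_le[OF le sn sums_summable[OF geo]])
  also have "\<dots> = (1/3) ^ m / 2" using sums_unique[OF geo] by (simp add: field_simps)
  also have "\<dots> < \<bar>d m\<bar>" using m b[of m] b'[of m] by (auto simp: d_def abs_mult)
  finally show False using dm by simp
qed

text \<open>Uniform limit of finite sums by the Weierstrass test. The index map
  \<open>\<iota>\<close> picks the digits to be read: a subsequence for a coordinate, all of them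
  for the ternary code.\<close>

lemma continuous_on_digit_sum:
  fixes r :: real
  assumes "0 < r" "r < 1"
  shows "continuous_on (PiE UNIV (\<lambda>_. {0, 1})) (\<lambda>b. \<Sum>k. b (\<iota> k) * r ^ k)"
proof (rule uniform_limit_theorem)
  show "uniform_limit (PiE UNIV (\<lambda>_. {0, 1})) (\<lambda>n b. \<Sum>k<n. b (\<iota> k) * r ^ k) (\<lambda>b. \<Sum>k. b (\<iota> k) * r ^ k) sequentially"
  proof (rule Weierstrass_m_test[of _ _ "\<lambda>k. r ^ k"])
    fix k and b :: "'a \<Rightarrow> real" assume "b \<in> PiE UNIV (\<lambda>_. {0, 1})"
    then have "b (\<iota> k) \<in> {0, 1}" by (rule PiE_mem) simp
    then show "norm (b (\<iota> k) * r ^ k) \<le> r ^ k" using assms by auto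
  qed (use assms in \<open>simp add: summable_geometric\<close>)
qed (auto intro!: always_eventually continuous_on_sum continuous_on_mult continuous_on_const continuous_on_fun_component)

text \<open>The real parameter is a point of a Cantor set; its ternary digits, split into countably many
  subsequences, are the binary digits of the coordinates.\<close>

lemma compact_eq_image_of_compact_real:
  fixes X :: "(nat \<Rightarrow> real) set"
  assumes "compact X"
  obtains K :: "real set" and g where "compact K" "continuous_on K g" "g ` K = X"
proof -
  let ?B = "PiE UNIV (\<lambda>_::nat. {0, 1::real})"
  have "\<exists>R>0. \<forall>x\<in>X. \<bar>x j\<bar> \<le> R" for j
  proof -
    have "compact ((\<lambda>x. x j) ` X)"
      by (intro compact_continuous_image continuous_on_fun_component assms)
    then show ?thesis using compact_imp_bounded[of "(\<lambda>x. x j) ` X"] by (auto simp: bounded_pos)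
  qed
  then obtain R where R: "\<And>j. R j > 0" "\<And>j x. x \<in> X \<Longrightarrow> \<bar>x j\<bar> \<le> R j" by metis
  \<comment> \<open>The series starts at \<open>k = 0\<close> and so ranges over
    \<open>[0, 2]\<close>; shifting by 1 and scaling by \<open>R j\<close> covers
    \<open>[- R j, R j]\<close>, which contains the \<open>j\<close>-th coordinates of
    \<open>X\<close>.\<close>
  define h where "h b = (\<lambda>j. R j * ((\<Sum>k. b (prod_encode (j, k)) * (1/2) ^ k) - 1))" for b :: "nat \<Rightarrow> real"
  define c where "c b = (\<Sum>k. b k * (1/3::real) ^ k)" for b :: "nat \<Rightarrow> real"
  have ch: "continuous_on ?B h"
    unfolding h_def
    by (intro continuous_on_coordinatewise_then_product continuous_on_mult continuous_on_diff continuous_on_const continuous_on_digit_sum) auto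
  have cc: "continuous_on ?B c"
    unfolding c_def using continuous_on_digit_sum[of "1/3" "\<lambda>k. k"] by simp
  have compB: "compact ?B" by (intro compact_PiE) auto
  \<comment> \<open>\<open>h\<close> covers a whole product of intervals; keeping the digit
    sequences that land in \<open>X\<close> leaves a closed part of a compact space.\<close>
  define B' where "B' = ?B \<inter> h -` X"
  have "compact B'"
  proof -
    have "closed B'" unfolding B'_def
      by (intro continuous_closed_preimage ch compact_imp_closed compB assms)
    then have "compact (?B \<inter> B')" by (intro compact_Int_closed compB)
    then show ?thesis by (simp add: B'_def Int_absorb1 inf.assoc[symmetric])
  qed
  have inj: "inj_on c B'"
  proof (rule inj_onI)
    fix b b' assume "b \<in> B'" "b' \<in> B'" "c b = c b'"
    then show "b = b'" unfolding c_def
      by (intro ternary_expansion_inj) (auto simp: B'_def PiE_iff)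
  qed
  have ccB: "continuous_on B' c" using cc by (rule continuous_on_subset) (auto simp: B'_def)
  have inv: "\<forall>b\<in>B'. the_inv_into B' c (c b) = b" using inj by (auto intro: the_inv_into_f_f)
  \<comment> \<open>A continuous injection of a compact set has a continuous inverse, so the ternary
    codes can be decoded continuously; \<open>h\<close> itself need not be injective.\<close>
  have ci: "continuous_on (c ` B') (the_inv_into B' c)"
    by (rule continuous_on_inv[OF ccB \<open>compact B'\<close> inv])
  have img: "h ` B' = X"
  proof (intro equalityI subsetI)
    fix x assume x: "x \<in> X"
    \<comment> \<open>\<open>binary_expansion\<close> works on \<open>[0, 1]\<close>, so the
      coordinate is rescaled; the factor 2 restored afterwards turns \<open>(1/2) ^ Suc k\<close>
      into the \<open>(1/2) ^ k\<close> of \<open>h\<close>.\<close>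
    have "\<exists>b. (\<forall>k. b k \<in> {0, 1::real}) \<and> (\<lambda>k. b k * (1/2) ^ Suc k) sums ((x j / R j + 1) / 2)" for j
    proof -
      have "x j / R j \<le> 1" "- 1 \<le> x j / R j" using R(1)[of j] R(2)[OF x, of j] by (auto simp: field_simps)
      then have "(x j / R j + 1) / 2 \<in> {0..1}" by auto
      from binary_expansion[OF this] show ?thesis by metis
    qed
    then obtain b where b: "\<And>j k. b j k \<in> {0, 1::real}"
      "\<And>j. (\<lambda>k. b j k * (1/2) ^ Suc k) sums ((x j / R j + 1) / 2)" by metis
    define b' where "b' m = b (fst (prod_decode m)) (snd (prod_decode m))" for m
    have "(\<lambda>k. 2 * (b j k * (1/2) ^ Suc k)) sums (2 * ((x j / R j + 1) / 2))" for j
      by (intro sums_mult b)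
    moreover have "(\<lambda>k. 2 * (b j k * (1/2) ^ Suc k)) = (\<lambda>k. b j k * (1/2) ^ k)" for j
      by auto
    moreover have "2 * ((x j / R j + 1) / 2) = x j / R j + 1" for j
      using nonzero_mult_div_cancel_left[of 2 "x j / R j + 1"] by (simp only: times_divide_eq_right)
    ultimately have "(\<lambda>k. b j k * (1/2) ^ k) sums (x j / R j + 1)" for j
      by metis
    then have "(\<Sum>k. b j k * (1/2) ^ k) = x j / R j + 1" for j
      by (metis sums_unique)
    then have "h b' j = x j" for j
      using R(1)[of j] by (simp add: h_def b'_def)
    then have "h b' = x" by (rule ext)
    moreover have "b' \<in> ?B" unfolding b'_def by (intro PiE_I b(1)) auto
    ultimately show "x \<in> h ` B'" using x by (auto simp: B'_def)
  qed (auto simp: B'_def)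
  show ?thesis
  proof
    show "compact (c ` B')" using ccB \<open>compact B'\<close> by (rule compact_continuous_image)
    have sub: "the_inv_into B' c ` (c ` B') = B'" using inv by (force simp: image_image)
    show "continuous_on (c ` B') (h \<circ> the_inv_into B' c)"
      by (intro continuous_on_compose ci) (use sub ch in \<open>auto simp: B'_def intro: continuous_on_subset\<close>)
    show "(h \<circ> the_inv_into B' c) ` (c ` B') = X" using sub img by (metis image_comp)
  qed
qed

section \<open>Convergent representations of sequences of measures\<close>

lemma distr_PiM:
  assumes "finite I"
    and M: "\<And>i. i \<in> I \<Longrightarrow> prob_space (M i)"
    and f [measurable]: "\<And>i. i \<in> I \<Longrightarrow> f i \<in> M i \<rightarrow>\<^sub>M N i"
  shows "distr (PiM I M) (PiM I N) (\<lambda>x. \<lambda>i\<in>I. f i (x i)) = PiM I (\<lambda>i. distr (M i) (N i) (f i))"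
proof -
  \<comment> \<open>\<open>product_prob_space\<close> asks for a probability measure at every index,
    while \<open>M\<close> is arbitrary outside \<open>I\<close>; a point mass fills the gap and
    leaves \<open>PiM I\<close> unchanged.\<close>
  define M' where "M' i = (if i \<in> I then M i else return (count_space UNIV) undefined)" for i
  define D where "D i = (if i \<in> I then distr (M i) (N i) (f i) else return (count_space UNIV) undefined)" for i
  interpret M': product_prob_space M'
    by (rule product_prob_spaceI) (auto simp: M'_def M intro!: prob_space_return)
  interpret D: product_prob_space D
    by (rule product_prob_spaceI) (auto simp: D_def M f intro!: prob_space_return prob_space.prob_space_distr)
  have PM: "PiM I M' = PiM I M" and PD: "PiM I D = PiM I (\<lambda>i. distr (M i) (N i) (f i))"
    by (intro PiM_cong; simp add: M'_def D_def)+
  have meas [measurable]: "(\<lambda>x. \<lambda>i\<in>I. f i (x i)) \<in> PiM I M \<rightarrow>\<^sub>M PiM I N"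
    by measurable
  have "distr (PiM I M) (PiM I N) (\<lambda>x. \<lambda>i\<in>I. f i (x i)) = PiM I D"
  \<comment> \<open>Rectangles determine the product measure, and they pull back to
    rectangles.\<close>
  proof (rule D.PiM_eqI[OF \<open>finite I\<close>])
    show "sets (distr (PiM I M) (PiM I N) (\<lambda>x. \<lambda>i\<in>I. f i (x i))) = sets (PiM I D)"
      by (auto simp: D_def intro!: sets_PiM_cong)
    fix A assume "\<And>i. i \<in> I \<Longrightarrow> A i \<in> sets (D i)"
    then have A: "\<And>i. i \<in> I \<Longrightarrow> A i \<in> sets (N i)" by (auto simp: D_def)
    have "emeasure (distr (PiM I M) (PiM I N) (\<lambda>x. \<lambda>i\<in>I. f i (x i))) (PiE I A) =
        emeasure (PiM I M) ((\<lambda>x. \<lambda>i\<in>I. f i (x i)) -` PiE I A \<inter> space (PiM I M))"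
      by (intro emeasure_distr meas sets_PiM_I_finite \<open>finite I\<close> A)
    also have "(\<lambda>x. \<lambda>i\<in>I. f i (x i)) -` PiE I A \<inter> space (PiM I M) =
        PiE I (\<lambda>i. f i -` A i \<inter> space (M i))"
      by (auto simp: space_PiM PiE_iff)
    also have "emeasure (PiM I M) \<dots> = (\<Prod>i\<in>I. emeasure (M' i) (f i -` A i \<inter> space (M i)))"
      unfolding PM[symmetric] using A by (intro M'.emeasure_PiM \<open>finite I\<close>) (auto simp: M'_def)
    also have "\<dots> = (\<Prod>i\<in>I. emeasure (D i) (A i))"
      by (intro prod.cong) (auto simp: M'_def D_def emeasure_distr A)
    finally show "emeasure (distr (PiM I M) (PiM I N) (\<lambda>x. \<lambda>i\<in>I. f i (x i))) (PiE I A) =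
        (\<Prod>i\<in>I. emeasure (D i) (A i))" .
  qed
  then show ?thesis by (simp add: PD)
qed

lemma integral_PiM_distr:
  fixes g :: "('i \<Rightarrow> 'b) \<Rightarrow> real" and f :: "'i \<Rightarrow> 'a \<Rightarrow> 'b"
  assumes "finite I" "\<And>i. i \<in> I \<Longrightarrow> prob_space (M i)"
    and f [measurable]: "\<And>i. i \<in> I \<Longrightarrow> f i \<in> M i \<rightarrow>\<^sub>M N i"
    and [measurable]: "g \<in> borel_measurable (PiM I N)"
  shows "(\<integral>x. g x \<partial>PiM I (\<lambda>i. distr (M i) (N i) (f i))) = (\<integral>x. g (\<lambda>i\<in>I. f i (x i)) \<partial>PiM I M)"
proof -
  have "PiM I (\<lambda>i. distr (M i) (N i) (f i)) = distr (PiM I M) (PiM I N) (\<lambda>x. \<lambda>i\<in>I. f i (x i))"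
    by (rule distr_PiM[symmetric]) fact+
  moreover have "(\<lambda>x. \<lambda>i\<in>I. f i (x i)) \<in> PiM I M \<rightarrow>\<^sub>M PiM I N" by measurable
  ultimately show ?thesis by (simp only: integral_distr assms)
qed

text \<open>A singleton of the product is a rectangle, so every subset of the finite product is
  measurable and masses multiply. Expected costs in a finite game thereby become finite
  sums.\<close>

lemma PiM_point_measure:
  fixes w :: "'i \<Rightarrow> 'a \<Rightarrow> real"
  assumes I: "finite I" and A: "\<And>i. i \<in> I \<Longrightarrow> finite (A i)"
    and w: "\<And>i a. i \<in> I \<Longrightarrow> a \<in> A i \<Longrightarrow> 0 \<le> w i a"
  shows "PiM I (\<lambda>i. point_measure (A i) (w i)) = point_measure (PiE I A) (\<lambda>x. \<Prod>i\<in>I. w i (x i))"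
proof -
  define M where "M i = (if i \<in> I then point_measure (A i) (w i) else count_space {undefined})" for i
  interpret M: product_sigma_finite M
  proof (rule product_sigma_finite.intro)
    fix i
    have "finite_measure (M i)"
      using A by (intro finite_measureI) (auto simp: M_def space_point_measure emeasure_point_measure_finite)
    then show "sigma_finite_measure (M i)" by (simp add: finite_measure.axioms)
  qed
  have PM: "PiM I (\<lambda>i. point_measure (A i) (w i)) = PiM I M"
    by (intro PiM_cong) (auto simp: M_def)
  have fin: "finite (PiE I A)" by (intro finite_PiE I A)
  have sing: "{x} = PiE I (\<lambda>i. {x i})" if "x \<in> PiE I A" for x
    using that PiE_singleton[of x I] by (simp add: PiE_iff)
  have sing_sets: "{x} \<in> sets (PiM I M)" if "x \<in> PiE I A" for x
    unfolding sing[OF that]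
    by (rule sets_PiM_I_finite[OF I]) (use that in \<open>auto simp: M_def sets_point_measure\<close>)
  show ?thesis unfolding PM
  proof (rule measure_eqI_finite[OF _ _ fin])
    show "sets (PiM I M) = Pow (PiE I A)"
    proof (intro equalityI subsetI)
      fix B assume "B \<in> sets (PiM I M)"
      then show "B \<in> Pow (PiE I A)"
        using sets.sets_into_space[of B "PiM I M"] by (auto simp: space_PiM M_def space_point_measure cong: PiE_cong)
    next
      fix B assume "B \<in> Pow (PiE I A)"
      then have "(\<Union>x\<in>B. {x}) \<in> sets (PiM I M)"
        using fin by (intro sets.finite_UN sing_sets) (auto dest: finite_subset)
      then show "B \<in> sets (PiM I M)" by simp
    qed
    fix x assume x: "x \<in> PiE I A"
    have "emeasure (PiM I M) {x} = (\<Prod>i\<in>I. emeasure (M i) {x i})"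
      by (subst sing[OF x], rule M.emeasure_PiM[OF I])
        (use x in \<open>auto simp: M_def sets_point_measure\<close>)
    also have "\<dots> = (\<Prod>i\<in>I. ennreal (w i (x i)))"
      using x A by (intro prod.cong) (auto simp: M_def emeasure_point_measure_finite PiE_mem)
    also have "\<dots> = ennreal (\<Prod>i\<in>I. w i (x i))"
      using x w by (intro prod_ennreal) (auto simp: PiE_mem)
    also have "\<dots> = emeasure (point_measure (PiE I A) (\<lambda>x. \<Prod>i\<in>I. w i (x i))) {x}"
      using x fin by (simp add: emeasure_point_measure_finite)
    finally show "emeasure (PiM I M) {x} = emeasure (point_measure (PiE I A) (\<lambda>x. \<Prod>i\<in>I. w i (x i))) {x}" .
  qed (simp add: sets_point_measure)
qed

section \<open>Subsequences of tight families and representing random variables\<close>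

lemma weak_conv_m_subseq: "weak_conv_m \<mu> M \<Longrightarrow> strict_mono r \<Longrightarrow> weak_conv_m (\<mu> \<circ> r) M"
  using LIMSEQ_subseq_LIMSEQ by (fastforce simp: weak_conv_m_def weak_conv_def o_def)

text \<open>Extract for one index after another: a further subsequence keeps the limits already
  found, so finitely many extractions compose to one \<open>r\<close>.\<close>

lemma tight_family_convergent_subsequence:
  fixes \<mu> :: "'i \<Rightarrow> nat \<Rightarrow> real measure"
  assumes "finite I" "\<And>i. i \<in> I \<Longrightarrow> tight (\<mu> i)"
  obtains r M where "strict_mono r"
    "\<And>i. i \<in> I \<Longrightarrow> real_distribution (M i)" "\<And>i. i \<in> I \<Longrightarrow> weak_conv_m (\<mu> i \<circ> r) (M i)"
proof -
  have "\<exists>r M. strict_mono r \<and> (\<forall>i\<in>I. real_distribution (M i) \<and> weak_conv_m (\<mu> i \<circ> r) (M i))"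
    using assms
  proof (induction I rule: finite_induct)
    case empty
    show ?case by (intro exI[of _ "\<lambda>n. n"]) (simp add: strict_mono_def)
  next
    case (insert j I)
    then obtain r M where r: "strict_mono r"
      "\<forall>i\<in>I. real_distribution (M i) \<and> weak_conv_m (\<mu> i \<circ> r) (M i)"
      using insert.IH[OF insert.prems[OF insertI2]] by blast
    obtain r' M' where r': "strict_mono (r' :: nat \<Rightarrow> nat)" "real_distribution M'" "weak_conv_m (\<mu> j \<circ> r \<circ> r') M'"
      using tight_imp_convergent_subsubsequence[OF insert.prems[of j] r(1)] by auto
    have "weak_conv_m (\<mu> i \<circ> r \<circ> r') (M i)" if "i \<in> I" for i
      using weak_conv_m_subseq[OF _ r'(1)] r(2) that by blast
    then have "\<forall>i\<in>insert j I. real_distribution ((M(j := M')) i) \<and>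
        weak_conv_m (\<mu> i \<circ> r \<circ> r') ((M(j := M')) i)"
      using r(2) r'(2,3) by simp
    then have "\<forall>i\<in>insert j I. real_distribution ((M(j := M')) i) \<and>
        weak_conv_m (\<mu> i \<circ> (r \<circ> r')) ((M(j := M')) i)"
      by (simp only: o_assoc)
    then show ?case using strict_mono_o[OF r(1) r'(1)] by blast
  qed
  then show ?thesis using that by blast
qed

text \<open>Discreteness of \<open>Q\<close> makes every selection \<open>X i \<Rightarrow> K i\<close> of the parametrisation measurable along \<open>s i\<close>.\<close>

lemma convergent_representation:
  fixes X :: "'i \<Rightarrow> (nat \<Rightarrow> real) set" and Q :: "'i \<Rightarrow> nat \<Rightarrow> 'b measure"
  assumes "finite I"
    and X: "\<And>i. i \<in> I \<Longrightarrow> compact (X i)"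
    and Q: "\<And>i n. i \<in> I \<Longrightarrow> prob_space (Q i n)"
    and discrete: "\<And>i n. i \<in> I \<Longrightarrow> sets (Q i n) = Pow (space (Q i n))"
    and s: "\<And>i n x. i \<in> I \<Longrightarrow> x \<in> space (Q i n) \<Longrightarrow> s i x \<in> X i"
  obtains r :: "nat \<Rightarrow> nat" and \<Omega> :: "'i \<Rightarrow> real measure" and Z :: "'i \<Rightarrow> nat \<Rightarrow> real \<Rightarrow> nat \<Rightarrow> real"
    and Z' :: "'i \<Rightarrow> real \<Rightarrow> nat \<Rightarrow> real"
  where "strict_mono r" "\<And>i. i \<in> I \<Longrightarrow> prob_space (\<Omega> i)"
    "\<And>i n. i \<in> I \<Longrightarrow> Z i n \<in> \<Omega> i \<rightarrow>\<^sub>M restrict_space borel (X i)"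
    "\<And>i. i \<in> I \<Longrightarrow> Z' i \<in> \<Omega> i \<rightarrow>\<^sub>M restrict_space borel (X i)"
    "\<And>i n. i \<in> I \<Longrightarrow> distr (\<Omega> i) (restrict_space borel (X i)) (Z i n) =
        distr (Q i (r n)) (restrict_space borel (X i)) (s i)"
    "\<And>i \<omega>. i \<in> I \<Longrightarrow> \<omega> \<in> space (\<Omega> i) \<Longrightarrow> (\<lambda>n. Z i n \<omega>) \<longlonglongrightarrow> Z' i \<omega>"
proof -
  have "\<exists>(K :: real set) g. compact K \<and> continuous_on K g \<and> g ` K = X i" if "i \<in> I" for i
    using compact_eq_image_of_compact_real[OF X[OF that]] by metis
  then obtain K :: "'i \<Rightarrow> real set" and g where K: "\<And>i. i \<in> I \<Longrightarrow> compact (K i)"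
    "\<And>i. i \<in> I \<Longrightarrow> continuous_on (K i) (g i)" and gK: "\<And>i. i \<in> I \<Longrightarrow> g i ` K i = X i" by metis
  \<comment> \<open>A right inverse of \<open>g i\<close> without any regularity. It moves the laws
    to \<open>K i\<close>, where Helly and Skorohod apply; since \<open>g i (e i x) = x\<close>,
    applying \<open>g i\<close> afterwards recovers the original laws.\<close>
  define e where "e i = inv_into (K i) (g i)" for i
  have e: "e i x \<in> K i" "g i (e i x) = x" if "i \<in> I" "x \<in> X i" for i x
    using that gK by (auto simp: e_def inv_into_into f_inv_into_f)
  define \<mu> where "\<mu> i n = distr (Q i n) borel (e i \<circ> s i)" for i n
  have esm: "e i \<circ> s i \<in> borel_measurable (Q i n)" if "i \<in> I" for i n
    using discrete[OF that] by (auto simp: measurable_def)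
  have rd: "real_distribution (\<mu> i n)" if "i \<in> I" for i n
    unfolding \<mu>_def using prob_space.prob_space_distr[OF Q esm] that
    by (auto simp: real_distribution_def real_distribution_axioms_def)
  have full: "measure (\<mu> i n) A = 1" if "i \<in> I" "K i \<subseteq> A" "A \<in> sets borel" for i n A
  proof -
    have "measure (\<mu> i n) A = measure (Q i n) ((e i \<circ> s i) -` A \<inter> space (Q i n))"
      unfolding \<mu>_def using that by (intro measure_distr esm)
    also have "(e i \<circ> s i) -` A \<inter> space (Q i n) = space (Q i n)"
      using that e(1) s by fastforce
    finally show ?thesis using prob_space.prob_space[OF Q] that by simp
  qed
  have "tight (\<mu> i)" if i: "i \<in> I" for i
  proof -
    obtain R where R: "R > 0" "\<And>x. x \<in> K i \<Longrightarrow> \<bar>x\<bar> \<le> R"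
      using compact_imp_bounded[OF K(1)[OF i]] by (auto simp: bounded_pos)
    \<comment> \<open>\<open>tight\<close> uses intervals open on the left, so the left end is moved
      one unit beyond \<open>-R\<close>.\<close>
    then have "K i \<subseteq> {-R-1<..R}" by (fastforce simp: abs_le_iff)
    then have "measure (\<mu> i n) {-R-1<..R} = 1" for n using full i by simp
    moreover have "-R-1 < R" using R(1) by simp
    ultimately show ?thesis using rd i unfolding tight_def
      by (intro conjI allI impI exI[of _ "-R-1"] exI[of _ R]) auto
  qed
  then obtain r M where r: "strict_mono r" and M: "\<And>i. i \<in> I \<Longrightarrow> real_distribution (M i)"
    and conv: "\<And>i. i \<in> I \<Longrightarrow> weak_conv_m (\<mu> i \<circ> r) (M i)"
    using tight_family_convergent_subsequence[OF \<open>finite I\<close>] by metis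
  define R where "R i \<Omega> Z Z' \<longleftrightarrow> prob_space \<Omega> \<and> (\<forall>n. Z n \<in> \<Omega> \<rightarrow>\<^sub>M restrict_space borel (X i)) \<and>
      Z' \<in> \<Omega> \<rightarrow>\<^sub>M restrict_space borel (X i) \<and>
      (\<forall>n. distr \<Omega> (restrict_space borel (X i)) (Z n) = distr (Q i (r n)) (restrict_space borel (X i)) (s i)) \<and>
      (\<forall>\<omega>\<in>space \<Omega>. (\<lambda>n. Z n \<omega>) \<longlonglongrightarrow> Z' \<omega>)" for i and \<Omega> :: "real measure" and Z Z'
  have "\<exists>\<Omega> Z Z'. R i \<Omega> Z Z'" if i: "i \<in> I" for i
  proof -
    have rd': "\<And>n. real_distribution ((\<mu> i \<circ> r) n)" using rd i by simp
    obtain \<Omega> :: "real measure" and Y Y' where "prob_space \<Omega>"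
      and Y [measurable]: "\<And>n. Y n \<in> borel_measurable \<Omega>"
      and dY: "\<And>n. distr \<Omega> borel (Y n) = \<mu> i (r n)"
      and Y'l: "Y' \<in> measurable \<Omega> lborel"
      and lim: "\<And>\<omega>. \<omega> \<in> space \<Omega> \<Longrightarrow> (\<lambda>n. Y n \<omega>) \<longlonglongrightarrow> Y' \<omega>"
      using Skorohod[OF rd' M[OF i] conv[OF i], unfolded o_apply] by blast
    have Y' [measurable]: "Y' \<in> borel_measurable \<Omega>" using Y'l by simp
    interpret prob_space \<Omega> by fact
    let ?B = "restrict_space borel (X i)"
    have [measurable]: "K i \<in> sets borel" using K(1)[OF i] by (simp add: borel_compact)
    have "space (Q i 0) \<noteq> {}" using prob_space.not_empty[OF Q[OF i]] .
    then obtain x0 where x0: "x0 \<in> X i" using s[OF i] by blast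
    \<comment> \<open>Extends \<open>g i\<close> to a Borel map on the whole line with values in
      \<open>X i\<close>, because the Skorohod variables may leave \<open>K i\<close> on a null
      set.\<close>
    define h where "h u = (if u \<in> K i then g i u else x0)" for u
    have hX: "h u \<in> X i" for u using gK[OF i] x0 by (auto simp: h_def)
    have "h \<in> borel_measurable borel"
      unfolding h_def[abs_def]
      by (intro borel_measurable_continuous_on_if continuous_on_const K i) measurable
    then have h [measurable]: "h \<in> borel \<rightarrow>\<^sub>M ?B"
      using hX by (intro measurable_restrict_space2) auto
    \<comment> \<open>On \<open>G\<close> the limit \<open>Y'\<close> lies in the closed set
      \<open>K i\<close>, where \<open>g i\<close> is continuous. Off \<open>G\<close>, a null set,
      all variables are replaced by one constant: convergence then holds at every point and the laws
      are unchanged.\<close>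
    define G where "G = {\<omega>\<in>space \<Omega>. \<forall>n. Y n \<omega> \<in> K i}"
    have [measurable]: "G \<in> sets \<Omega>" unfolding G_def by measurable
    have AEG: "AE \<omega> in \<Omega>. \<omega> \<in> G"
    proof -
      have "AE \<omega> in \<Omega>. Y n \<omega> \<in> K i" for n
      proof -
        have "measure (distr \<Omega> borel (Y n)) (K i) = 1" unfolding dY by (rule full[OF i]) auto
        then have "prob (Y n -` K i \<inter> space \<Omega>) = 1" by (simp add: measure_distr)
        then have "AE \<omega> in \<Omega>. \<omega> \<in> Y n -` K i \<inter> space \<Omega>" by (intro AE_prob_1) auto
        then show ?thesis by auto
      qed
      then have "AE \<omega> in \<Omega>. \<forall>n. Y n \<omega> \<in> K i" by (simp add: AE_all_countable)
      then show ?thesis by (auto simp: G_def)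
    qed
    define Z where "Z n \<omega> = h (if \<omega> \<in> G then Y n \<omega> else e i x0)" for n \<omega>
    define Z' where "Z' \<omega> = h (if \<omega> \<in> G then Y' \<omega> else e i x0)" for \<omega>
    have Zm [measurable]: "Z n \<in> \<Omega> \<rightarrow>\<^sub>M ?B" for n unfolding Z_def[abs_def] by measurable
    have Z'm: "Z' \<in> \<Omega> \<rightarrow>\<^sub>M ?B" unfolding Z'_def[abs_def] by measurable
    have "distr \<Omega> ?B (Z n) = distr (Q i (r n)) ?B (s i)" for n
    proof -
      have "distr \<Omega> ?B (Z n) = distr \<Omega> ?B (h \<circ> Y n)"
        by (rule distr_cong_AE) (use AEG in \<open>auto simp: Z_def\<close>)
      also have "\<dots> = distr (distr \<Omega> borel (Y n)) ?B h"
        by (rule distr_distr[symmetric]) measurable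
      also have "\<dots> = distr (Q i (r n)) ?B (h \<circ> (e i \<circ> s i))"
        unfolding dY \<mu>_def by (rule distr_distr) (use esm[OF i] in measurable)
      also have "\<dots> = distr (Q i (r n)) ?B (s i)"
        by (rule distr_cong) (use e[OF i] s[OF i] in \<open>auto simp: h_def\<close>)
      finally show ?thesis .
    qed
    moreover have "(\<lambda>n. Z n \<omega>) \<longlonglongrightarrow> Z' \<omega>" if "\<omega> \<in> space \<Omega>" for \<omega>
    proof (cases "\<omega> \<in> G")
      case True
      then have YK: "\<And>n. Y n \<omega> \<in> K i" by (simp add: G_def)
      have Y'K: "Y' \<omega> \<in> K i"
        using closed_sequentially[OF compact_imp_closed[OF K(1)[OF i]] YK lim[OF that]] .
      have "(\<lambda>n. g i (Y n \<omega>)) \<longlonglongrightarrow> g i (Y' \<omega>)"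
        by (rule continuous_on_tendsto_compose[OF K(2)[OF i] lim[OF that] Y'K]) (simp add: YK)
      then show ?thesis using True YK Y'K by (simp add: Z_def Z'_def h_def)
    qed (simp add: Z_def Z'_def)
    ultimately have "R i \<Omega> Z Z'" using Z'm \<open>prob_space \<Omega>\<close> Zm by (simp add: R_def)
    then show ?thesis by blast
  qed
  then obtain \<Omega> Z Z' where "\<And>i. i \<in> I \<Longrightarrow> R i (\<Omega> i) (Z i) (Z' i)" by metis
  then show ?thesis by (intro that[OF r, of \<Omega> Z Z']) (simp_all only: R_def)
qed

section \<open>Mixed equilibria of continuous games\<close>

locale continuous_game =
  fixes I :: "'i::countable set"
    and X :: "'i \<Rightarrow> (nat \<Rightarrow> real) set"
    and \<phi> :: "'i \<Rightarrow> ('i \<Rightarrow> nat \<Rightarrow> real) \<Rightarrow> real"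
  assumes finite_I: "finite I"
    and compact_X: "\<And>i. i \<in> I \<Longrightarrow> compact (X i)"
    and X_nonempty: "\<And>i. i \<in> I \<Longrightarrow> X i \<noteq> {}"
    and continuous_\<phi>: "\<And>i. i \<in> I \<Longrightarrow> continuous_on (PiE I X) (\<phi> i)"
begin

abbreviation strategies :: "'i \<Rightarrow> (nat \<Rightarrow> real) measure" where
  "strategies i \<equiv> restrict_space borel (X i)"

definition pure_cost :: "('i \<Rightarrow> (nat \<Rightarrow> real) measure) \<Rightarrow> 'i \<Rightarrow> (nat \<Rightarrow> real) \<Rightarrow> real" where
  "pure_cost \<nu> i t = (\<integral>x. \<phi> i (x(i := t)) \<partial>PiM (I - {i}) \<nu>)"

lemma mixed_cost_eq: "mixed_cost I \<phi> \<nu> i \<mu> = (\<integral>t. pure_cost \<nu> i t \<partial>\<mu>)"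
  by (simp add: mixed_cost_def pure_cost_def)

lemma pure_cost_cong:
  assumes "\<And>j. j \<in> I \<Longrightarrow> \<nu> j = \<nu>' j"
  shows "pure_cost \<nu> i = pure_cost \<nu>' i"
proof -
  have "PiM (I - {i}) \<nu> = PiM (I - {i}) \<nu>'" by (rule PiM_cong) (use assms in auto)
  then show ?thesis by (simp add: pure_cost_def fun_eq_iff)
qed

section \<open>Bounds and measurability of the objectives\<close>

lemma \<phi>_bounded:
  assumes "i \<in> I"
  obtains B where "\<And>x. x \<in> PiE I X \<Longrightarrow> \<bar>\<phi> i x\<bar> \<le> B"
proof -
  have "compact (\<phi> i ` PiE I X)"
    by (intro compact_continuous_image continuous_\<phi> compact_PiE compact_X assms)
  then show ?thesis using that compact_imp_bounded[of "\<phi> i ` PiE I X"] by (auto simp: bounded_iff)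
qed

text \<open>\<open>\<phi> i\<close> is controlled only on \<open>PiE I X\<close>, so the composition
  passes through the Borel structure restricted to that set. Over a countable index type
  coordinatewise measurability suffices; coordinates outside \<open>I\<close> are constantly
  \<open>undefined\<close>.\<close>

lemma measurable_\<phi>:
  assumes "i \<in> I" and g: "\<And>x. x \<in> space M \<Longrightarrow> g x \<in> PiE I X"
    and meas: "\<And>j. j \<in> I \<Longrightarrow> (\<lambda>x. g x j) \<in> borel_measurable M"
  shows "(\<lambda>x. \<phi> i (g x)) \<in> borel_measurable M"
proof -
  have "(\<lambda>x. g x j) \<in> borel_measurable M" for j
  proof (cases "j \<in> I")
    case False
    then have "g x j = undefined" if "x \<in> space M" for x
      using PiE_arb[OF g[OF that]] by simp
    then show ?thesis by (subst measurable_cong[where g = "\<lambda>_. undefined"]) auto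
  qed (rule meas)
  then have "g \<in> borel_measurable M" by (rule measurable_coordinatewise_then_product)
  then have "g \<in> M \<rightarrow>\<^sub>M restrict_space borel (PiE I X)"
    using g by (intro measurable_restrict_space2) auto
  from measurable_comp[OF this borel_measurable_continuous_on_restrict[OF continuous_\<phi>[OF \<open>i \<in> I\<close>]]]
  show ?thesis by (simp add: o_def)
qed

lemma measurable_deviation:
  assumes "i \<in> I" "t \<in> X i"
  shows "(\<lambda>x. \<phi> i (x(i := t))) \<in> borel_measurable (PiM (I - {i}) strategies)"
proof (rule measurable_\<phi>[OF \<open>i \<in> I\<close>])
  show "x(i := t) \<in> PiE I X" if "x \<in> space (PiM (I - {i}) strategies)" for x
    using that assms by (auto simp: space_PiM space_restrict_space PiE_iff extensional_def)
  fix j assume "j \<in> I"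
  show "(\<lambda>x. (x(i := t)) j) \<in> borel_measurable (PiM (I - {i}) strategies)"
  proof (cases "j = i")
    case False
    have "(\<lambda>x. x j) \<in> PiM (I - {i}) strategies \<rightarrow>\<^sub>M strategies j"
      using \<open>j \<in> I\<close> False by (intro measurable_component_singleton) auto
    then have "(\<lambda>x. x j) \<in> borel_measurable (PiM (I - {i}) strategies)"
      by (simp add: measurable_restrict_space2_iff)
    then show ?thesis using False by simp
  qed simp
qed

section \<open>Convergence of costs along random variables\<close>

context
  fixes \<Omega> :: "'i \<Rightarrow> 'w measure"
  assumes \<Omega>: "\<And>j. j \<in> I \<Longrightarrow> prob_space (\<Omega> j)"
begin

lemma pure_cost_distr:
  assumes "i \<in> I" "t \<in> X i" and "\<And>j. j \<in> I \<Longrightarrow> Z j \<in> \<Omega> j \<rightarrow>\<^sub>M strategies j"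
  shows "pure_cost (\<lambda>j. distr (\<Omega> j) (strategies j) (Z j)) i t =
      (\<integral>\<omega>. \<phi> i ((\<lambda>j\<in>I - {i}. Z j (\<omega> j))(i := t)) \<partial>PiM (I - {i}) \<Omega>)"
  unfolding pure_cost_def
  using finite_I assms \<Omega> by (intro integral_PiM_distr measurable_deviation) auto

text \<open>On the product of the \<open>\<Omega> j\<close> the profiles converge pointwise and
  \<open>\<phi> i\<close> is bounded, so dominated convergence applies. The player's own strategy
  \<open>t m\<close> may move as well: this gives continuity in \<open>t\<close> when the laws are
  fixed, and the joint limit in \<open>mixed_cost_tendsto\<close>.\<close>

lemma pure_cost_tendsto:
  assumes i: "i \<in> I"
    and Z: "\<And>j m. j \<in> I \<Longrightarrow> Z j m \<in> \<Omega> j \<rightarrow>\<^sub>M strategies j"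
    and Z': "\<And>j. j \<in> I \<Longrightarrow> Z' j \<in> \<Omega> j \<rightarrow>\<^sub>M strategies j"
    and lim: "\<And>j \<omega>. j \<in> I \<Longrightarrow> \<omega> \<in> space (\<Omega> j) \<Longrightarrow> (\<lambda>m. Z j m \<omega>) \<longlonglongrightarrow> Z' j \<omega>"
    and t: "\<And>m. t m \<in> X i" "t' \<in> X i" "t \<longlonglongrightarrow> t'"
  shows "(\<lambda>m. pure_cost (\<lambda>j. distr (\<Omega> j) (strategies j) (Z j m)) i (t m)) \<longlonglongrightarrow>
      pure_cost (\<lambda>j. distr (\<Omega> j) (strategies j) (Z' j)) i t'"
proof -
  let ?J = "I - {i}"
  interpret prob_space "PiM ?J \<Omega>" by (intro prob_space_PiM \<Omega>) auto
  obtain B where B: "\<And>x. x \<in> PiE I X \<Longrightarrow> \<bar>\<phi> i x\<bar> \<le> B" using \<phi>_bounded[OF i] by blast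
  have mem: "(\<lambda>j\<in>?J. U j (\<omega> j))(i := u) \<in> PiE I X"
    if U: "\<And>j. j \<in> I \<Longrightarrow> U j \<in> \<Omega> j \<rightarrow>\<^sub>M strategies j" and "u \<in> X i" and \<omega>: "\<omega> \<in> space (PiM ?J \<Omega>)" for U u \<omega>
  proof -
    have "U j (\<omega> j) \<in> X j" if "j \<in> ?J" for j
      using measurable_space[OF U, of j "\<omega> j"] \<omega> that by (auto simp: space_PiM PiE_iff space_restrict_space)
    then show ?thesis using i \<open>u \<in> X i\<close> by (auto simp: PiE_iff extensional_def)
  qed
  have meas: "(\<lambda>\<omega>. \<phi> i ((\<lambda>j\<in>?J. U j (\<omega> j))(i := u))) \<in> borel_measurable (PiM ?J \<Omega>)"
    if U [measurable]: "\<And>j. j \<in> I \<Longrightarrow> U j \<in> \<Omega> j \<rightarrow>\<^sub>M strategies j" and u: "u \<in> X i" for U u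
  proof -
    have "(\<lambda>\<omega>. \<lambda>j\<in>?J. U j (\<omega> j)) \<in> PiM ?J \<Omega> \<rightarrow>\<^sub>M PiM ?J strategies"
      by measurable
    from measurable_comp[OF this measurable_deviation[OF i u]] show ?thesis by (simp only: o_def)
  qed
  have "(\<lambda>m. \<integral>\<omega>. \<phi> i ((\<lambda>j\<in>?J. Z j m (\<omega> j))(i := t m)) \<partial>PiM ?J \<Omega>) \<longlonglongrightarrow>
      (\<integral>\<omega>. \<phi> i ((\<lambda>j\<in>?J. Z' j (\<omega> j))(i := t')) \<partial>PiM ?J \<Omega>)"
  proof (rule integral_dominated_convergence[where w = "\<lambda>_. B"])
    show "AE \<omega> in PiM ?J \<Omega>. (\<lambda>m. \<phi> i ((\<lambda>j\<in>?J. Z j m (\<omega> j))(i := t m))) \<longlonglongrightarrow> \<phi> i ((\<lambda>j\<in>?J. Z' j (\<omega> j))(i := t'))"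
    proof (rule AE_I2)
      fix \<omega> assume \<omega>: "\<omega> \<in> space (PiM ?J \<Omega>)"
      have in_X: "\<And>m. (\<lambda>j\<in>?J. Z j m (\<omega> j))(i := t m) \<in> PiE I X" "(\<lambda>j\<in>?J. Z' j (\<omega> j))(i := t') \<in> PiE I X"
        using mem[OF Z t(1) \<omega>] mem[OF Z' t(2) \<omega>] by auto
      have "(\<lambda>m. (\<lambda>j\<in>?J. Z j m (\<omega> j))(i := t m)) \<longlonglongrightarrow> (\<lambda>j\<in>?J. Z' j (\<omega> j))(i := t')"
      proof (rule tendsto_PiE[OF in_X])
        fix j assume "j \<in> I"
        then show "(\<lambda>m. ((\<lambda>j\<in>?J. Z j m (\<omega> j))(i := t m)) j) \<longlonglongrightarrow> ((\<lambda>j\<in>?J. Z' j (\<omega> j))(i := t')) j"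
          using t(3) lim[of j "\<omega> j"] \<omega> by (cases "j = i") (auto simp: space_PiM PiE_iff)
      qed
      then show "(\<lambda>m. \<phi> i ((\<lambda>j\<in>?J. Z j m (\<omega> j))(i := t m))) \<longlonglongrightarrow> \<phi> i ((\<lambda>j\<in>?J. Z' j (\<omega> j))(i := t'))"
        by (rule continuous_on_tendsto_compose[OF continuous_\<phi>[OF i]]) (use in_X in auto)
    qed
    show "AE \<omega> in PiM ?J \<Omega>. norm (\<phi> i ((\<lambda>j\<in>?J. Z j m (\<omega> j))(i := t m))) \<le> B" for m
      using B mem[OF Z t(1)] by (intro AE_I2) auto
    show "(\<lambda>\<omega>. \<phi> i ((\<lambda>j\<in>?J. Z' j (\<omega> j))(i := t'))) \<in> borel_measurable (PiM ?J \<Omega>)"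
      by (rule meas[OF Z' t(2)])
    show "(\<lambda>\<omega>. \<phi> i ((\<lambda>j\<in>?J. Z j m (\<omega> j))(i := t m))) \<in> borel_measurable (PiM ?J \<Omega>)" for m
      by (rule meas[OF Z t(1)])
  qed simp
  then show ?thesis
    using pure_cost_distr[OF i t(1) Z] pure_cost_distr[OF i t(2) Z'] by simp
qed

end

section \<open>Costs at a fixed mixed profile, and their limits\<close>

lemma borel_probs_distr_id: "\<nu> \<in> borel_probs (X j) \<Longrightarrow> distr \<nu> (strategies j) (\<lambda>x. x) = \<nu>"
  by (intro distr_id2) (simp add: mem_borel_probs_iff)

lemma measurable_id_borel_probs: "\<nu> \<in> borel_probs (X j) \<Longrightarrow> (\<lambda>x. x) \<in> \<nu> \<rightarrow>\<^sub>M strategies j"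
  by (intro measurable_ident_sets) (simp add: mem_borel_probs_iff)

lemma distr_in_borel_probs:
  "prob_space \<Omega> \<Longrightarrow> Z \<in> \<Omega> \<rightarrow>\<^sub>M strategies j \<Longrightarrow> distr \<Omega> (strategies j) Z \<in> borel_probs (X j)"
  by (simp add: mem_borel_probs_iff prob_space.prob_space_distr)

context
  fixes \<nu> :: "'i \<Rightarrow> (nat \<Rightarrow> real) measure"
  assumes \<nu>: "\<And>j. j \<in> I \<Longrightarrow> \<nu> j \<in> borel_probs (X j)"
begin

lemma continuous_on_pure_cost:
  assumes "i \<in> I"
  shows "continuous_on (X i) (pure_cost \<nu> i)"
proof -
  \<comment> \<open>Every law is represented by the identity on its own space; with these variables
    constant in \<open>m\<close>, \<open>pure_cost_tendsto\<close> moves only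
    \<open>t\<close>.\<close>
  have eq: "pure_cost (\<lambda>j. distr (\<nu> j) (strategies j) (\<lambda>x. x)) i = pure_cost \<nu> i"
    by (rule pure_cost_cong) (simp add: borel_probs_distr_id \<nu>)
  show ?thesis unfolding continuous_on_sequentially
  proof (intro allI ballI impI)
    fix t t' assume "t' \<in> X i" and "(\<forall>n. t n \<in> X i) \<and> t \<longlonglongrightarrow> t'"
    then have "(\<lambda>m. pure_cost (\<lambda>j. distr (\<nu> j) (strategies j) (\<lambda>x. x)) i (t m)) \<longlonglongrightarrow>
        pure_cost (\<lambda>j. distr (\<nu> j) (strategies j) (\<lambda>x. x)) i t'"
      using \<nu> assms by (intro pure_cost_tendsto) (auto simp: mem_borel_probs_iff measurable_id_borel_probs)
    then show "(pure_cost \<nu> i \<circ> t) \<longlonglongrightarrow> pure_cost \<nu> i t'" by (simp add: eq o_def)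
  qed
qed

lemma pure_cost_measurable: "i \<in> I \<Longrightarrow> pure_cost \<nu> i \<in> borel_measurable (strategies i)"
  by (intro borel_measurable_continuous_on_restrict continuous_on_pure_cost)

text \<open>The bound does not depend on \<open>\<nu>\<close>, so it can dominate the outer
  integrals when the profile varies.\<close>

lemma pure_cost_bound:
  assumes i: "i \<in> I" and "t \<in> X i" and B: "\<And>x. x \<in> PiE I X \<Longrightarrow> \<bar>\<phi> i x\<bar> \<le> B"
  shows "\<bar>pure_cost \<nu> i t\<bar> \<le> B"
proof -
  let ?M = "PiM (I - {i}) \<nu>"
  interpret prob_space ?M by (intro prob_space_PiM) (use \<nu> in \<open>auto simp: mem_borel_probs_iff\<close>)
  have sets: "sets ?M = sets (PiM (I - {i}) strategies)"
    by (intro sets_PiM_cong) (use \<nu> in \<open>auto simp: mem_borel_probs_iff\<close>)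
  have [measurable]: "(\<lambda>x. \<phi> i (x(i := t))) \<in> borel_measurable ?M"
    using measurable_deviation[OF i \<open>t \<in> X i\<close>] by (simp add: measurable_cong_sets[OF sets])
  have bound: "\<bar>\<phi> i (x(i := t))\<bar> \<le> B" if "x \<in> space ?M" for x
    using that assms sets_eq_imp_space_eq[OF sets]
    by (intro B) (auto simp: space_PiM space_restrict_space PiE_iff extensional_def)
  have int: "integrable ?M (\<lambda>x. \<phi> i (x(i := t)))"
    by (rule integrable_const_bound[of _ B]) (use bound in auto)
  have "AE x in ?M. \<phi> i (x(i := t)) \<le> B" "AE x in ?M. - B \<le> \<phi> i (x(i := t))"
    using bound by (auto simp: abs_le_iff intro!: AE_I2) force+
  then show ?thesis
    using integral_le_const[OF int, of B] integral_ge_const[OF int, of "- B"]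
    by (simp add: pure_cost_def abs_le_iff minus_le_iff)
qed

end

text \<open>The outer integral is moved to \<open>\<Omega> i\<close>, where the player's own
  strategy \<open>Z i m\<close> varies at the same time as the opponents' laws.
  \<open>pure_cost_tendsto\<close> allows for both, and one dominated convergence remains.\<close>

lemma mixed_cost_tendsto:
  fixes \<Omega> :: "'i \<Rightarrow> 'w measure"
  assumes \<Omega>: "\<And>j. j \<in> I \<Longrightarrow> prob_space (\<Omega> j)"
    and i: "i \<in> I"
    and Z: "\<And>j m. j \<in> I \<Longrightarrow> Z j m \<in> \<Omega> j \<rightarrow>\<^sub>M strategies j"
    and Z': "\<And>j. j \<in> I \<Longrightarrow> Z' j \<in> \<Omega> j \<rightarrow>\<^sub>M strategies j"
    and lim: "\<And>j \<omega>. j \<in> I \<Longrightarrow> \<omega> \<in> space (\<Omega> j) \<Longrightarrow> (\<lambda>m. Z j m \<omega>) \<longlonglongrightarrow> Z' j \<omega>"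
  shows "(\<lambda>m. mixed_cost I \<phi> (\<lambda>j. distr (\<Omega> j) (strategies j) (Z j m)) i (distr (\<Omega> i) (strategies i) (Z i m))) \<longlonglongrightarrow>
      mixed_cost I \<phi> (\<lambda>j. distr (\<Omega> j) (strategies j) (Z' j)) i (distr (\<Omega> i) (strategies i) (Z' i))"
proof -
  interpret prob_space "\<Omega> i" by (rule \<Omega>[OF i])
  obtain B where B: "\<And>x. x \<in> PiE I X \<Longrightarrow> \<bar>\<phi> i x\<bar> \<le> B" using \<phi>_bounded[OF i] by blast
  define D where "D U j = distr (\<Omega> j) (strategies j) (U j)" for U :: "'i \<Rightarrow> 'w \<Rightarrow> nat \<Rightarrow> real" and j
  have D: "D U j \<in> borel_probs (X j)" if "\<And>j. j \<in> I \<Longrightarrow> U j \<in> \<Omega> j \<rightarrow>\<^sub>M strategies j" "j \<in> I" for U j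
    unfolding D_def using that \<Omega> by (intro distr_in_borel_probs)
  have meas: "(\<lambda>\<eta>. pure_cost (D U) i (U i \<eta>)) \<in> borel_measurable (\<Omega> i)"
    if U: "\<And>j. j \<in> I \<Longrightarrow> U j \<in> \<Omega> j \<rightarrow>\<^sub>M strategies j" for U
    using measurable_comp[OF U[OF i] pure_cost_measurable[OF D[OF U] i]] by (simp add: o_def)
  have eq: "mixed_cost I \<phi> (D U) i (D U i) = (\<integral>\<eta>. pure_cost (D U) i (U i \<eta>) \<partial>\<Omega> i)"
    if U: "\<And>j. j \<in> I \<Longrightarrow> U j \<in> \<Omega> j \<rightarrow>\<^sub>M strategies j" for U
  proof -
    have DU: "D U i = distr (\<Omega> i) (strategies i) (U i)" by (rule D_def)
    show ?thesis
      unfolding mixed_cost_eq DU by (rule integral_distr[OF U[OF i] pure_cost_measurable[OF D[OF U] i]])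
  qed
  have UX: "U \<eta> \<in> X i" if "U \<in> \<Omega> i \<rightarrow>\<^sub>M strategies i" "\<eta> \<in> space (\<Omega> i)" for U \<eta>
    using measurable_space[OF that] by (simp add: space_restrict_space)
  have "(\<lambda>m. \<integral>\<eta>. pure_cost (D (\<lambda>j. Z j m)) i (Z i m \<eta>) \<partial>\<Omega> i) \<longlonglongrightarrow> (\<integral>\<eta>. pure_cost (D Z') i (Z' i \<eta>) \<partial>\<Omega> i)"
  proof (rule integral_dominated_convergence[where w = "\<lambda>_. B"])
    show "AE \<eta> in \<Omega> i. (\<lambda>m. pure_cost (D (\<lambda>j. Z j m)) i (Z i m \<eta>)) \<longlonglongrightarrow> pure_cost (D Z') i (Z' i \<eta>)"
      unfolding D_def[abs_def]
      by (intro AE_I2 pure_cost_tendsto \<Omega> i Z Z' lim) (auto intro: UX Z Z' i)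
    show "AE \<eta> in \<Omega> i. norm (pure_cost (D (\<lambda>j. Z j m)) i (Z i m \<eta>)) \<le> B" for m
      using pure_cost_bound[OF D i _ B] Z i UX by (intro AE_I2) auto
  qed (use meas Z Z' in auto)
  then have "(\<lambda>m. mixed_cost I \<phi> (D (\<lambda>j. Z j m)) i (D (\<lambda>j. Z j m) i)) \<longlonglongrightarrow> mixed_cost I \<phi> (D Z') i (D Z' i)"
    using eq Z Z' by simp
  then show ?thesis by (simp add: D_def[abs_def])
qed

section \<open>From finite games to the continuous game\<close>

lemma finitely_supported_equilibrium:
  fixes s :: "'i \<Rightarrow> nat \<Rightarrow> nat \<Rightarrow> real"
  assumes "n > 0" and s: "\<And>i k. i \<in> I \<Longrightarrow> s i k \<in> X i"
  obtains Q where "\<And>i. i \<in> I \<Longrightarrow> prob_space (Q i)" "\<And>i. i \<in> I \<Longrightarrow> space (Q i) = {..<n}"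
    "\<And>i. i \<in> I \<Longrightarrow> sets (Q i) = Pow {..<n}"
    "\<And>i k. i \<in> I \<Longrightarrow> k < n \<Longrightarrow>
      mixed_cost I \<phi> (\<lambda>j. distr (Q j) (strategies j) (s j)) i (distr (Q i) (strategies i) (s i)) \<le>
      pure_cost (\<lambda>j. distr (Q j) (strategies j) (s j)) i (s i k)"
proof -
  \<comment> \<open>Expected cost of \<open>s i k\<close> in the finite game, written as a
    polynomial in the weights, which makes it continuous.\<close>
  define c where "c i k p = (\<Sum>x\<in>PiE (I - {i}) (\<lambda>_. {..<n}). (\<Prod>j\<in>I - {i}. p (j, x j)) *
      \<phi> i ((\<lambda>j\<in>I - {i}. s j (x j))(i := s i k)))" for i k and p :: "'i \<times> nat \<Rightarrow> real"
  have "continuous_on (mixed_weights I n) (c i k)" for i k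
    unfolding c_def
    by (intro continuous_on_sum continuous_on_mult continuous_on_prod continuous_on_fun_component continuous_on_const)
  then obtain p where p: "p \<in> mixed_weights I n"
    and opt: "\<And>i k. i \<in> I \<Longrightarrow> k < n \<Longrightarrow> (\<Sum>l<n. p (i, l) * c i l p) \<le> c i k p"
    using finite_nash[OF finite_I \<open>n > 0\<close>, of c] by metis
  \<comment> \<open>\<open>Q i\<close> lives on the indices rather than on the points
    \<open>s i k\<close>: repetitions in \<open>s i\<close> do no harm, and every subset is
    measurable, as \<open>convergent_representation\<close> demands.\<close>
  define Q where "Q i = point_measure {..<n} (\<lambda>k. p (i, k))" for i
  have p0: "0 \<le> p (i, k)" if "i \<in> I" "k < n" for i k
    using p that by (auto simp: mixed_weights_def PiE_iff)
  have spQ: "space (Q i) = {..<n}" "sets (Q i) = Pow {..<n}" for i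
    by (simp_all add: Q_def space_point_measure sets_point_measure)
  have Q: "prob_space (Q i)" if "i \<in> I" for i
  proof
    have "emeasure (Q i) (space (Q i)) = (\<Sum>k<n. ennreal (p (i, k)))"
      unfolding spQ by (simp add: Q_def emeasure_point_measure_finite)
    also have "\<dots> = ennreal (\<Sum>k<n. p (i, k))" using p0[OF that] by (intro sum_ennreal) auto
    finally show "emeasure (Q i) (space (Q i)) = 1" using p that by (simp add: mixed_weights_def)
  qed
  have sQ: "s i \<in> Q i \<rightarrow>\<^sub>M strategies i" if "i \<in> I" for i
    using s[OF that] by (simp add: Q_def space_restrict_space)
  let ?\<nu> = "\<lambda>j. distr (Q j) (strategies j) (s j)"
  have \<nu>: "?\<nu> j \<in> borel_probs (X j)" if "j \<in> I" for j
    by (intro distr_in_borel_probs Q sQ that)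
  have pure: "pure_cost ?\<nu> i (s i k) = c i k p" if "i \<in> I" for i k
  proof -
    have "pure_cost ?\<nu> i (s i k) = (\<integral>\<omega>. \<phi> i ((\<lambda>j\<in>I - {i}. s j (\<omega> j))(i := s i k)) \<partial>PiM (I - {i}) Q)"
      by (rule pure_cost_distr[OF Q that s[OF that] sQ])
    also have "PiM (I - {i}) Q = point_measure (PiE (I - {i}) (\<lambda>_. {..<n})) (\<lambda>x. \<Prod>j\<in>I - {i}. p (j, x j))"
      unfolding Q_def by (rule PiM_point_measure) (use finite_I p0 in auto)
    also have "(\<integral>\<omega>. \<phi> i ((\<lambda>j\<in>I - {i}. s j (\<omega> j))(i := s i k)) \<partial>\<dots>) = c i k p"
      unfolding c_def
      by (subst lebesgue_integral_point_measure_finite)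
        (auto intro!: finite_PiE finite_I prod_nonneg p0 simp: PiE_iff)
    finally show ?thesis .
  qed
  have mixed: "mixed_cost I \<phi> ?\<nu> i (?\<nu> i) = (\<Sum>l<n. p (i, l) * c i l p)" if "i \<in> I" for i
  proof -
    have "mixed_cost I \<phi> ?\<nu> i (?\<nu> i) = (\<integral>k. pure_cost ?\<nu> i (s i k) \<partial>Q i)"
      unfolding mixed_cost_eq by (rule integral_distr[OF sQ[OF that] pure_cost_measurable[OF \<nu> that]])
    also have "\<dots> = (\<integral>k. c i k p \<partial>Q i)" by (simp only: pure[OF that])
    also have "\<dots> = (\<Sum>l<n. p (i, l) * c i l p)"
      unfolding Q_def
      by (subst lebesgue_integral_point_measure_finite) (use p0[OF that] in auto)
    finally show ?thesis .
  qed
  show ?thesis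
  proof (rule that[of Q])
    show "mixed_cost I \<phi> ?\<nu> i (?\<nu> i) \<le> pure_cost ?\<nu> i (s i k)" if "i \<in> I" "k < n" for i k
      unfolding mixed[OF that(1)] pure[OF that(1)] by (rule opt[OF that])
  qed (simp_all only: Q spQ)
qed

theorem mixed_equilibrium_exists: "\<exists>\<nu>. mixed_equilibrium I X \<phi> \<nu>"
proof -
  have "\<exists>s. (\<forall>k::nat. s k \<in> X i) \<and> X i \<subseteq> closure (range s)" if i: "i \<in> I" for i
  proof -
    obtain T where T: "countable T" "T \<subseteq> X i" "X i \<subseteq> closure T" using separable by blast
    have "T \<noteq> {}" using T(3) X_nonempty[OF i] by auto
    then have "range (from_nat_into T) = T" using T(1) by (rule range_from_nat_into)
    then show ?thesis using T by (intro exI[of _ "from_nat_into T"]) auto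
  qed
  then obtain s where s: "\<And>i k. i \<in> I \<Longrightarrow> s i (k::nat) \<in> X i"
    and dense: "\<And>i. i \<in> I \<Longrightarrow> X i \<subseteq> closure (range (s i))" by metis
  \<comment> \<open>Stage \<open>n\<close> uses the first \<open>Suc n\<close> points, so the finite
    game has a strategy even at \<open>n = 0\<close>.\<close>
  define eq where "eq n Q \<longleftrightarrow> (\<forall>i\<in>I. prob_space (Q i) \<and> space (Q i) = {..<Suc n} \<and> sets (Q i) = Pow {..<Suc n} \<and>
      (\<forall>k<Suc n. mixed_cost I \<phi> (\<lambda>j. distr (Q j) (strategies j) (s j)) i (distr (Q i) (strategies i) (s i)) \<le>
      pure_cost (\<lambda>j. distr (Q j) (strategies j) (s j)) i (s i k)))" for n Q
  have "\<exists>Q. eq n Q" for n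
  proof -
    obtain Q where "\<And>i. i \<in> I \<Longrightarrow> prob_space (Q i)" "\<And>i. i \<in> I \<Longrightarrow> space (Q i) = {..<Suc n}"
      "\<And>i. i \<in> I \<Longrightarrow> sets (Q i) = Pow {..<Suc n}"
      "\<And>i k. i \<in> I \<Longrightarrow> k < Suc n \<Longrightarrow>
        mixed_cost I \<phi> (\<lambda>j. distr (Q j) (strategies j) (s j)) i (distr (Q i) (strategies i) (s i)) \<le>
        pure_cost (\<lambda>j. distr (Q j) (strategies j) (s j)) i (s i k)"
      using finitely_supported_equilibrium[of "Suc n" s, OF zero_less_Suc s] by blast
    then have "eq n Q" unfolding eq_def by blast
    then show ?thesis by blast
  qed
  then obtain Q' where "\<And>n. eq n (Q' n)" by metis
  then have Q': "\<And>n i. i \<in> I \<Longrightarrow> prob_space (Q' n i)" "\<And>n i. i \<in> I \<Longrightarrow> space (Q' n i) = {..<Suc n}"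
    "\<And>n i. i \<in> I \<Longrightarrow> sets (Q' n i) = Pow {..<Suc n}"
    and opt: "\<And>n i k. i \<in> I \<Longrightarrow> k < Suc n \<Longrightarrow>
      mixed_cost I \<phi> (\<lambda>j. distr (Q' n j) (strategies j) (s j)) i (distr (Q' n i) (strategies i) (s i)) \<le>
      pure_cost (\<lambda>j. distr (Q' n j) (strategies j) (s j)) i (s i k)"
    unfolding eq_def by blast+
  obtain r :: "nat \<Rightarrow> nat" and \<Omega> :: "'i \<Rightarrow> real measure" and Z Z'
    where r: "strict_mono r" and \<Omega>: "\<And>i. i \<in> I \<Longrightarrow> prob_space (\<Omega> i)"
    and Z: "\<And>i n. i \<in> I \<Longrightarrow> Z i n \<in> \<Omega> i \<rightarrow>\<^sub>M strategies i"
    and Z': "\<And>i. i \<in> I \<Longrightarrow> Z' i \<in> \<Omega> i \<rightarrow>\<^sub>M strategies i"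
    and distrZ: "\<And>i n. i \<in> I \<Longrightarrow> distr (\<Omega> i) (strategies i) (Z i n) = distr (Q' (r n) i) (strategies i) (s i)"
    and lim: "\<And>i \<omega>. i \<in> I \<Longrightarrow> \<omega> \<in> space (\<Omega> i) \<Longrightarrow> (\<lambda>n. Z i n \<omega>) \<longlonglongrightarrow> Z' i \<omega>"
  proof (rule convergent_representation[OF finite_I, of X "\<lambda>i n. Q' n i" s])
    show "sets (Q' n i) = Pow (space (Q' n i))" if "i \<in> I" for i n by (simp only: Q' that)
  qed (blast intro: compact_X Q' s)+
  let ?D = "\<lambda>n j. distr (\<Omega> j) (strategies j) (Z j n)"
  define \<nu> where "\<nu> j = distr (\<Omega> j) (strategies j) (Z' j)" for j
  have \<nu>: "\<nu> j \<in> borel_probs (X j)" if "j \<in> I" for j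
    unfolding \<nu>_def by (intro distr_in_borel_probs \<Omega> Z' that)
  have le_dense: "mixed_cost I \<phi> \<nu> i (\<nu> i) \<le> pure_cost \<nu> i (s i k)" if i: "i \<in> I" for i k
  proof (rule LIMSEQ_le)
    show "(\<lambda>n. mixed_cost I \<phi> (?D n) i (?D n i)) \<longlonglongrightarrow> mixed_cost I \<phi> \<nu> i (\<nu> i)"
      unfolding \<nu>_def[abs_def] by (rule mixed_cost_tendsto[OF \<Omega> i Z Z' lim])
    show "(\<lambda>n. pure_cost (?D n) i (s i k)) \<longlonglongrightarrow> pure_cost \<nu> i (s i k)"
      unfolding \<nu>_def[abs_def] by (rule pure_cost_tendsto[OF \<Omega> i Z Z' lim s[OF i] s[OF i] tendsto_const])
    show "\<exists>N. \<forall>n\<ge>N. mixed_cost I \<phi> (?D n) i (?D n i) \<le> pure_cost (?D n) i (s i k)"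
    proof (intro exI allI impI)
      \<comment> \<open>From \<open>n = k\<close> on, the point \<open>s i k\<close> is among the
        competing strategies, because \<open>r n \<ge> n\<close>.\<close>
      fix n assume "k \<le> n"
      then have "k < Suc (r n)" using seq_suble[OF r, of n] by simp
      note opt[OF i this]
      moreover have "pure_cost (?D n) i = pure_cost (\<lambda>j. distr (Q' (r n) j) (strategies j) (s j)) i"
        by (rule pure_cost_cong) (rule distrZ)
      ultimately show "mixed_cost I \<phi> (?D n) i (?D n i) \<le> pure_cost (?D n) i (s i k)"
        by (simp only: mixed_cost_eq distrZ[OF i])
    qed
  qed
  have le_pure: "mixed_cost I \<phi> \<nu> i (\<nu> i) \<le> pure_cost \<nu> i t" if i: "i \<in> I" and t: "t \<in> X i" for i t
  proof -
    have "t \<in> closure (range (s i))" using dense[OF i] t by (rule subsetD)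
    then obtain u where u: "\<And>n. u n \<in> range (s i)" "u \<longlonglongrightarrow> t"
      by (metis closure_sequential)
    have "u n \<in> X i" for n using u(1)[of n] s[OF i] by auto
    then have "(\<lambda>n. pure_cost \<nu> i (u n)) \<longlonglongrightarrow> pure_cost \<nu> i t"
      by (intro continuous_on_tendsto_compose[OF continuous_on_pure_cost[OF \<nu> i] u(2) t]) auto
    moreover have "mixed_cost I \<phi> \<nu> i (\<nu> i) \<le> pure_cost \<nu> i (u n)" for n
      using u(1)[of n] le_dense[OF i] by auto
    ultimately show ?thesis by (intro LIMSEQ_le_const) auto
  qed
  have "mixed_cost I \<phi> \<nu> i (\<nu> i) \<le> mixed_cost I \<phi> \<nu> i \<mu>" if i: "i \<in> I" and \<mu>: "\<mu> \<in> borel_probs (X i)" for i \<mu>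
  proof -
    interpret prob_space \<mu> using \<mu> by (simp add: mem_borel_probs_iff)
    have sets\<mu>: "sets \<mu> = sets (strategies i)" using \<mu> by (simp add: mem_borel_probs_iff)
    have sp: "space \<mu> = X i" using sets_eq_imp_space_eq[OF sets\<mu>] by (simp add: space_restrict_space)
    obtain B where B: "\<And>x. x \<in> PiE I X \<Longrightarrow> \<bar>\<phi> i x\<bar> \<le> B" using \<phi>_bounded[OF i] by blast
    have "pure_cost \<nu> i \<in> borel_measurable \<mu>"
      using pure_cost_measurable[OF \<nu> i] by (simp add: measurable_cong_sets[OF sets\<mu>])
    \<comment> \<open>Integrability has to be secured: the Bochner integral of a non-integrable
      function is 0, and a pointwise lower bound would not pass to it.\<close>
    then have "integrable \<mu> (pure_cost \<nu> i)"
      using pure_cost_bound[OF \<nu> i _ B] sp by (intro integrable_const_bound[of _ B]) auto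
    then show ?thesis unfolding mixed_cost_eq[of \<nu> i \<mu>]
      by (rule integral_ge_const) (use le_pure[OF i] sp in auto)
  qed
  then show ?thesis using \<nu> unfolding mixed_equilibrium_def by blast
qed

end

section \<open>Plain bilevel games in the Bayesian approach\<close>

text \<open>Integrand and measure both vary with \<open>x\<close>. Freezing the integrand at the
  limit point leaves a case of weak convergence; the error of freezing is small uniformly in
  \<open>y\<close>, hence under every probability measure on \<open>Y\<close>.\<close>

lemma continuous_on_bayes_cost:
  fixes X :: "'a::metric_space set" and Y :: "'b::metric_space set"
  assumes "compact X" "compact Y"
    and cont: "continuous_on (X \<times> Y) (\<theta> i)"
    and \<beta>: "belief X Y S (\<beta> i)" and wc: "weak_continuous_on X Y (\<beta> i)"
  shows "continuous_on X (bayes_cost \<theta> \<beta> i)"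
  unfolding continuous_on_sequentially
proof (intro allI ballI impI)
  fix u x assume x: "x \<in> X" and "(\<forall>n. u n \<in> X) \<and> u \<longlonglongrightarrow> x"
  then have u: "\<And>n. u n \<in> X" "u \<longlonglongrightarrow> x" by auto
  have prob: "prob_space (\<beta> i z)" and sets: "sets (\<beta> i z) = sets (restrict_space borel Y)" if "z \<in> X" for z
    using \<beta> that by (auto simp: belief_def mem_borel_probs_iff)
  have sp: "space (\<beta> i z) = Y" if "z \<in> X" for z
    using sets_eq_imp_space_eq[OF sets[OF that]] by (simp add: space_restrict_space)
  have cont_y: "continuous_on Y (\<lambda>y. \<theta> i (z, y))" if "z \<in> X" for z
    by (rule continuous_on_compose2[OF cont]) (use that in \<open>auto intro!: continuous_intros\<close>)
  have int: "integrable (\<beta> i z) (\<lambda>y. \<theta> i (z', y))" if z: "z \<in> X" "z' \<in> X" for z z'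
  proof -
    interpret prob_space "\<beta> i z" by (rule prob[OF z(1)])
    have "compact ((\<lambda>y. \<theta> i (z', y)) ` Y)" by (rule compact_continuous_image[OF cont_y[OF z(2)] \<open>compact Y\<close>])
    then obtain B where "\<And>y. y \<in> Y \<Longrightarrow> \<bar>\<theta> i (z', y)\<bar> \<le> B"
      using compact_imp_bounded[of "(\<lambda>y. \<theta> i (z', y)) ` Y"] by (auto simp: bounded_iff)
    moreover have "(\<lambda>y. \<theta> i (z', y)) \<in> borel_measurable (\<beta> i z)"
      using borel_measurable_continuous_on_restrict[OF cont_y[OF z(2)]]
      by (simp add: measurable_cong_sets[OF sets[OF z(1)]])
    ultimately show ?thesis using sp[OF z(1)] by (intro integrable_const_bound[of _ B]) auto
  qed
  \<comment> \<open>\<open>Y\<close> is bounded, so every continuous function on it is a test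
    function.\<close>
  have "bounded {y \<in> Y. \<theta> i (x, y) \<noteq> 0}"
    using compact_imp_bounded[OF \<open>compact Y\<close>] by (rule bounded_subset) auto
  then have weak: "(\<lambda>n. \<integral>y. \<theta> i (x, y) \<partial>\<beta> i (u n)) \<longlonglongrightarrow> (\<integral>y. \<theta> i (x, y) \<partial>\<beta> i x)"
    using wc x u cont_y[OF x] unfolding weak_continuous_on_def weak_conv_on_def by blast
  have diff: "(\<lambda>n. (\<integral>y. \<theta> i (u n, y) \<partial>\<beta> i (u n)) - (\<integral>y. \<theta> i (x, y) \<partial>\<beta> i (u n))) \<longlonglongrightarrow> 0"
  proof (rule LIMSEQ_I)
    fix r :: real assume "0 < r"
    have "uniformly_continuous_on (X \<times> Y) (\<theta> i)"
      using cont \<open>compact X\<close> \<open>compact Y\<close> by (intro compact_uniformly_continuous compact_Times)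
    \<comment> \<open>Integration preserves only weak inequalities; \<open>r / 2\<close> leaves room
      for the strict one at the end.\<close>
    then obtain \<delta> where \<delta>: "\<delta> > 0" "\<And>p q. p \<in> X \<times> Y \<Longrightarrow> q \<in> X \<times> Y \<Longrightarrow> dist q p < \<delta> \<Longrightarrow> dist (\<theta> i q) (\<theta> i p) < r / 2"
      using \<open>0 < r\<close> unfolding uniformly_continuous_on_def by (meson half_gt_zero)
    obtain N where N: "\<And>n. n \<ge> N \<Longrightarrow> dist (u n) x < \<delta>"
      using metric_LIMSEQ_D[OF u(2) \<delta>(1)] by blast
    show "\<exists>N. \<forall>n\<ge>N. norm ((\<integral>y. \<theta> i (u n, y) \<partial>\<beta> i (u n)) - (\<integral>y. \<theta> i (x, y) \<partial>\<beta> i (u n)) - 0) < r"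
    proof (intro exI allI impI)
      fix n assume "N \<le> n"
      interpret prob_space "\<beta> i (u n)" by (rule prob[OF u(1)])
      let ?f = "\<lambda>y. \<theta> i (u n, y) - \<theta> i (x, y)"
      have close: "\<bar>?f y\<bar> \<le> r / 2" if "y \<in> Y" for y
        using \<delta>(2)[of "(x, y)" "(u n, y)"] N[OF \<open>N \<le> n\<close>] u(1) x that by (auto simp: dist_Pair_Pair dist_real_def)
      have i: "integrable (\<beta> i (u n)) ?f" using int u(1) x by auto
      have "AE y in \<beta> i (u n). ?f y \<le> r / 2" "AE y in \<beta> i (u n). - (r / 2) \<le> ?f y"
        using close[THEN abs_le_D1] close[THEN abs_le_D2] sp[OF u(1)] by (intro AE_I2; force)+
      then have "\<bar>\<integral>y. ?f y \<partial>\<beta> i (u n)\<bar> \<le> r / 2"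
        using integral_le_const[OF i, of "r / 2"] integral_ge_const[OF i, of "- (r / 2)"] by (simp add: abs_le_iff)
      moreover have "(\<integral>y. ?f y \<partial>\<beta> i (u n)) = (\<integral>y. \<theta> i (u n, y) \<partial>\<beta> i (u n)) - (\<integral>y. \<theta> i (x, y) \<partial>\<beta> i (u n))"
        using int u(1) x by (intro Bochner_Integration.integral_diff) auto
      ultimately show "norm ((\<integral>y. \<theta> i (u n, y) \<partial>\<beta> i (u n)) - (\<integral>y. \<theta> i (x, y) \<partial>\<beta> i (u n)) - 0) < r"
        using \<open>0 < r\<close> by simp
    qed
  qed
  from tendsto_add[OF diff weak] show "(bayes_cost \<theta> \<beta> i \<circ> u) \<longlonglongrightarrow> bayes_cost \<theta> \<beta> i x"
    by (simp add: bayes_cost_def o_def)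
qed

theorem theorem3:
  fixes N :: nat
    and d :: "nat \<Rightarrow> nat"
    and X :: "nat \<Rightarrow> (nat \<Rightarrow> real) set"
    and Y :: "(real ^ 'p) set"
    and S :: "(nat \<Rightarrow> nat \<Rightarrow> real) \<Rightarrow> (real ^ 'p) set"
    and \<theta> :: "nat \<Rightarrow> (nat \<Rightarrow> nat \<Rightarrow> real) \<times> (real ^ 'p) \<Rightarrow> real"
    and \<beta> :: "nat \<Rightarrow> (nat \<Rightarrow> nat \<Rightarrow> real) \<Rightarrow> (real ^ 'p) measure"
  assumes "Y \<noteq> {}" and "compact Y"
    and "\<And>i. i \<in> {1..N} \<Longrightarrow> X i \<subseteq> topspace (Euclidean_space (d i))"
    and "\<And>x. x \<in> (\<Pi>\<^sub>E i\<in>{1..N}. X i) \<Longrightarrow> S x \<noteq> {} \<and> S x \<subseteq> Y"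
    and "closedin (top_of_set ((\<Pi>\<^sub>E i\<in>{1..N}. X i) \<times> Y))
           {(x, y). x \<in> (\<Pi>\<^sub>E i\<in>{1..N}. X i) \<and> y \<in> S x}"
    and "\<And>i. i \<in> {1..N} \<Longrightarrow> belief (\<Pi>\<^sub>E i\<in>{1..N}. X i) Y S (\<beta> i)"
    and "\<And>i. i \<in> {1..N} \<Longrightarrow> continuous_on ((\<Pi>\<^sub>E i\<in>{1..N}. X i) \<times> Y) (\<theta> i)"
    and "\<And>i. i \<in> {1..N} \<Longrightarrow> X i \<noteq> {} \<and> compact (X i)"
    and "\<And>i. i \<in> {1..N} \<Longrightarrow> weak_continuous_on (\<Pi>\<^sub>E i\<in>{1..N}. X i) Y (\<beta> i)"
  shows "(\<forall>i\<in>{1..N}. continuous_on (\<Pi>\<^sub>E i\<in>{1..N}. X i) (bayes_cost \<theta> \<beta> i)) \<and>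
         (\<exists>\<nu>. mixed_equilibrium {1..N} X (bayes_cost \<theta> \<beta>) \<nu>)"
proof (intro conjI ballI)
  show cont: "continuous_on (\<Pi>\<^sub>E i\<in>{1..N}. X i) (bayes_cost \<theta> \<beta> i)" if "i \<in> {1..N}" for i
    using assms that by (intro continuous_on_bayes_cost[where Y = Y and S = S] compact_PiE) auto
  \<comment> \<open>The beliefs enter the game only through the continuity just shown.\<close>
  interpret continuous_game "{1..N}" X "bayes_cost \<theta> \<beta>"
    by standard (use assms(8) cont in auto)
  show "\<exists>\<nu>. mixed_equilibrium {1..N} X (bayes_cost \<theta> \<beta>) \<nu>"
    by (rule mixed_equilibrium_exists)
qed

end
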